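(* Let $G$ be a finitely generated group that splits over a subgroup $C$. Suppose that $C$ is finitely generated, has polynomial growth of degree $d>0$, and is quasi-isometrically embedded in $G$. If $\Gamma$ is the Cayley graph of $G$ with respect to a finite generating set $S$, then $\Gamma$ has the polynomial retaining property of degree $d-1$.
   Context: A group $G$ splits over a subgroup $C$ if either $G=A\ast_C B$ with $C$ a proper subgroup of both $A$ and $B$, or $G$ is an HNN-extension $A\ast_C$ (no assumptions on $C$). A finitely generated subgroup $C$ is quasi-isometrically embedded if, for a finite generating set $S$ of $G$ containing a finite generating set $T$ of $C$, the inclusion of $C$ with its word metric for $T$ into $G$ with its word metric for $S$ is a quasi-isometric embedding. Growth: for non-decreasing $f,g\colon\mathbb N\to\mathbb N$, $f\preceq g$ means there is an integer $C'>0$ with $f(n)\le C'g(C'n+C')+C'$ for all $n$, and $f\sim g$ means both; for a vertex set $Y$ with the restricted path-metric and nonempty finite $A\subseteq Y$, $\beta_{Y,A}(n)=|\{y\in Y:\mathrm{dist}(A,y)\le n\}|$ and $\mathsf{Growth}(Y)$ is its $\sim$-class. Fire game on a connected graph $\Gamma$ (reach $1$): for positive integers $\{f_n\}_{n\ge1}$, an $\{f_n\}$-strategy is a sequence $\{W_n\}_{n\ge1}$ of vertex sets with $|W_n|\le f_n$; for a finite initial fire $X_0$, for $n>0$ the set $X_n$ consists of vertices connected to a vertex of $X_{n-1}$ by a path of length at most $1$ containing no vertex of $(W_1\cup\cdots\cup W_n)\setminus X_{n-1}$. The strategy is retaining for $X_0$ if $U=V(\Gamma)\setminus\bigcup_nX_n$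 has $\mathsf{Growth}(U)=\mathsf{Growth}(\Gamma)$. $\Gamma$ has the polynomial retaining property of degree $e$ if there is $K>0$ such that every finite $X_0$ admits a retaining $\{Kn^e\}$-strategy. *)

theory Defs
  imports
    Complex_Main
    "HOL-Algebra.Group"
    "HOL-Algebra.Generated_Groups"
    "Graph_Theory.Vertex_Walk"
begin

section \<open>Generators and relations\<close>

inductive_set word_congruence :: "'x set \<Rightarrow> ('x list \<times> 'x list) set \<Rightarrow> ('x list \<times> 'x list) set"
  for X :: "'x set" and R :: "('x list \<times> 'x list) set"
  where
    refl: "u \<in> lists X \<Longrightarrow> (u, u) \<in> word_congruence X R"
  | rel: "\<lbrakk>(u, v) \<in> R; u \<in> lists X; v \<in> lists X; x \<in> lists X; y \<in> lists X\<rbrakk>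
      \<Longrightarrow> (x @ u @ y, x @ v @ y) \<in> word_congruence X R"
  | sym: "(u, v) \<in> word_congruence X R \<Longrightarrow> (v, u) \<in> word_congruence X R"
  | trans: "\<lbrakk>(u, v) \<in> word_congruence X R; (v, w) \<in> word_congruence X R\<rbrakk>
      \<Longrightarrow> (u, w) \<in> word_congruence X R"

definition word_class :: "'x set \<Rightarrow> ('x list \<times> 'x list) set \<Rightarrow> 'x list \<Rightarrow> 'x list set" where
  "word_class X R w = word_congruence X R `` {w}"

text \<open>
  The monoid presented by generators \<open>X\<close> and relations \<open>R\<close>. In the two uses below, the
  generators include the inverse of every generator and the relations make these cancel, so the
  presented monoid is the group with this presentation.
\<close>

definition presented_monoid :: "'x set \<Rightarrow> ('x list \<times> 'x list) set \<Rightarrow> 'x list set monoid" where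
  "presented_monoid X R =
    \<lparr>carrier = lists X // word_congruence X R,
     mult = (\<lambda>P Q. \<Union>u\<in>P. \<Union>v\<in>Q. word_class X R (u @ v)),
     one = word_class X R []\<rparr>"


section \<open>Amalgamated products and HNN-extensions\<close>

text \<open>
  \<open>amalgam A B C\<close> is \<open>A *\<^sub>C B\<close> for groups \<open>A\<close>, \<open>B\<close> sharing the subgroup \<open>C\<close>: letters are
  elements of \<open>A\<close> (tagged \<^term>\<open>Inl\<close>) and of \<open>B\<close> (tagged \<^term>\<open>Inr\<close>), with the
  multiplication tables of \<open>A\<close> and \<open>B\<close> and the identification of the two copies of \<open>C\<close>.
\<close>

definition amalgam_gens :: "('a, 'm) monoid_scheme \<Rightarrow> ('a, 'n) monoid_scheme \<Rightarrow> ('a + 'a) set" where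
  "amalgam_gens A B = Inl ` carrier A \<union> Inr ` carrier B"

definition amalgam_rels ::
    "('a, 'm) monoid_scheme \<Rightarrow> ('a, 'n) monoid_scheme \<Rightarrow> 'a set \<Rightarrow> (('a + 'a) list \<times> ('a + 'a) list) set"
  where
  "amalgam_rels A B C =
     {([Inl \<one>\<^bsub>A\<^esub>], []), ([Inr \<one>\<^bsub>B\<^esub>], [])}
   \<union> {([Inl x, Inl y], [Inl (x \<otimes>\<^bsub>A\<^esub> y)]) | x y. x \<in> carrier A \<and> y \<in> carrier A}
   \<union> {([Inr x, Inr y], [Inr (x \<otimes>\<^bsub>B\<^esub> y)]) | x y. x \<in> carrier B \<and> y \<in> carrier B}
   \<union> {([Inl c], [Inr c]) | c. c \<in> C}"

definition amalgam ::
    "('a, 'm) monoid_scheme \<Rightarrow> ('a, 'n) monoid_scheme \<Rightarrow> 'a set \<Rightarrow> ('a + 'a) list set monoid" where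
  "amalgam A B C = presented_monoid (amalgam_gens A B) (amalgam_rels A B C)"

text \<open>\<open>G = A *\<^sub>C B\<close>: the inclusions of \<open>A\<close> and \<open>B\<close> in \<open>G\<close> extend to an isomorphism.\<close>

definition is_amalgam :: "('a, 'm) monoid_scheme \<Rightarrow> 'a set \<Rightarrow> 'a set \<Rightarrow> 'a set \<Rightarrow> bool" where
  "is_amalgam G A B C \<longleftrightarrow>
     (let A' = G\<lparr>carrier := A\<rparr>; B' = G\<lparr>carrier := B\<rparr>;
          cls = word_class (amalgam_gens A' B') (amalgam_rels A' B' C)
      in \<exists>h \<in> iso (amalgam A' B' C) G.
           (\<forall>a\<in>A. h (cls [Inl a]) = a) \<and> (\<forall>b\<in>B. h (cls [Inr b]) = b))"

datatype 'a hnn_letter = Base 'a | Stable | Stable_inv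

text \<open>
  \<open>hnn A C \<phi>\<close> is the HNN-extension \<open>\<langle>A, t | t c t\<inverse> = \<phi>(c) for c \<in> C\<rangle>\<close>;
  the letters \<^term>\<open>Stable\<close> and \<^term>\<open>Stable_inv\<close> stand for \<open>t\<close> and its inverse.
\<close>

definition hnn_gens :: "('a, 'm) monoid_scheme \<Rightarrow> 'a hnn_letter set" where
  "hnn_gens A = Base ` carrier A \<union> {Stable, Stable_inv}"

definition hnn_rels ::
    "('a, 'm) monoid_scheme \<Rightarrow> 'a set \<Rightarrow> ('a \<Rightarrow> 'a) \<Rightarrow> ('a hnn_letter list \<times> 'a hnn_letter list) set"
  where
  "hnn_rels A C \<phi> =
     {([Base \<one>\<^bsub>A\<^esub>], []), ([Stable, Stable_inv], []), ([Stable_inv, Stable], [])}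
   \<union> {([Base x, Base y], [Base (x \<otimes>\<^bsub>A\<^esub> y)]) | x y. x \<in> carrier A \<and> y \<in> carrier A}
   \<union> {([Stable, Base c, Stable_inv], [Base (\<phi> c)]) | c. c \<in> C}"

definition hnn ::
    "('a, 'm) monoid_scheme \<Rightarrow> 'a set \<Rightarrow> ('a \<Rightarrow> 'a) \<Rightarrow> 'a hnn_letter list set monoid" where
  "hnn A C \<phi> = presented_monoid (hnn_gens A) (hnn_rels A C \<phi>)"

definition is_hnn :: "('a, 'm) monoid_scheme \<Rightarrow> 'a set \<Rightarrow> 'a set \<Rightarrow> ('a \<Rightarrow> 'a) \<Rightarrow> bool" where
  "is_hnn G A C \<phi> \<longleftrightarrow>
     (let A' = G\<lparr>carrier := A\<rparr>; cls = word_class (hnn_gens A') (hnn_rels A' C \<phi>)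
      in \<exists>h \<in> iso (hnn A' C \<phi>) G. \<forall>a\<in>A. h (cls [Base a]) = a)"

definition splits_over :: "('a, 'm) monoid_scheme \<Rightarrow> 'a set \<Rightarrow> bool" where
  "splits_over G C \<longleftrightarrow> subgroup C G \<and>
     ((\<exists>A B. subgroup A G \<and> subgroup B G \<and> C \<subset> A \<and> C \<subset> B \<and> is_amalgam G A B C)
    \<or> (\<exists>A \<phi>. subgroup A G \<and> C \<subseteq> A \<and>
          \<phi> \<in> mon (G\<lparr>carrier := C\<rparr>) (G\<lparr>carrier := A\<rparr>) \<and> is_hnn G A C \<phi>))"


section \<open>Graph distance, Cayley graphs\<close>

text \<open>
  Graphs are symmetric digraphs, as usual in the \<^theory>\<open>Graph_Theory.Digraph\<close> library. The
  distance is meaningful only for vertices joined by a walk; all graphs below are connected.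
\<close>

definition graph_dist :: "('v, 'e) pre_digraph \<Rightarrow> 'v \<Rightarrow> 'v \<Rightarrow> nat" where
  "graph_dist \<Gamma> u v = (LEAST n. \<exists>p. vwalk p \<Gamma> \<and> hd p = u \<and> last p = v \<and> vwalk_length p = n)"

definition finite_generating_set :: "('a, 'm) monoid_scheme \<Rightarrow> 'a set \<Rightarrow> bool" where
  "finite_generating_set G S \<longleftrightarrow> finite S \<and> S \<subseteq> carrier G \<and> generate G S = carrier G"

definition finitely_generated :: "('a, 'm) monoid_scheme \<Rightarrow> bool" where
  "finitely_generated G \<longleftrightarrow> (\<exists>S. finite_generating_set G S)"

definition cayley_graph :: "('a, 'm) monoid_scheme \<Rightarrow> 'a set \<Rightarrow> ('a, 'a \<times> 'a) pre_digraph" where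
  "cayley_graph G S =
    \<lparr>verts = carrier G,
     arcs = {(x, y). x \<in> carrier G \<and> y \<in> carrier G \<and> x \<noteq> y
               \<and> (\<exists>s\<in>S. y = x \<otimes>\<^bsub>G\<^esub> s \<or> x = y \<otimes>\<^bsub>G\<^esub> s)},
     tail = fst, head = snd\<rparr>"

abbreviation word_metric :: "('a, 'm) monoid_scheme \<Rightarrow> 'a set \<Rightarrow> 'a \<Rightarrow> 'a \<Rightarrow> nat" where
  "word_metric G S \<equiv> graph_dist (cayley_graph G S)"


section \<open>Quasi-isometrically embedded subgroups\<close>

definition quasi_isometric_embedding ::
    "'a set \<Rightarrow> ('a \<Rightarrow> 'a \<Rightarrow> nat) \<Rightarrow> ('b \<Rightarrow> 'b \<Rightarrow> nat) \<Rightarrow> ('a \<Rightarrow> 'b) \<Rightarrow> bool" where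
  "quasi_isometric_embedding X dX dY f \<longleftrightarrow>
     (\<exists>L c :: real. L \<ge> 1 \<and> c \<ge> 0 \<and>
        (\<forall>x\<in>X. \<forall>y\<in>X. real (dX x y) / L - c \<le> real (dY (f x) (f y))
                    \<and> real (dY (f x) (f y)) \<le> L * real (dX x y) + c))"

definition qi_embedded_subgroup :: "('a, 'm) monoid_scheme \<Rightarrow> 'a set \<Rightarrow> bool" where
  "qi_embedded_subgroup G C \<longleftrightarrow>
     (\<exists>S T. finite_generating_set G S \<and> finite_generating_set (G\<lparr>carrier := C\<rparr>) T \<and> T \<subseteq> S \<and>
        quasi_isometric_embedding C (word_metric (G\<lparr>carrier := C\<rparr>) T) (word_metric G S) (\<lambda>x. x))"


section \<open>Growth\<close>

definition growth_le :: "(nat \<Rightarrow> nat) \<Rightarrow> (nat \<Rightarrow> nat) \<Rightarrow> bool" (infix \<open>\<preceq>\<^sub>g\<close> 50) where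
  "f \<preceq>\<^sub>g g \<longleftrightarrow> (\<exists>k>0. \<forall>n. f n \<le> k * g (k * n + k) + k)"

definition growth_equiv :: "(nat \<Rightarrow> nat) \<Rightarrow> (nat \<Rightarrow> nat) \<Rightarrow> bool" (infix \<open>\<sim>\<^sub>g\<close> 50) where
  "f \<sim>\<^sub>g g \<longleftrightarrow> f \<preceq>\<^sub>g g \<and> g \<preceq>\<^sub>g f"

definition growth_class :: "(nat \<Rightarrow> nat) \<Rightarrow> (nat \<Rightarrow> nat) set" where
  "growth_class f = {g. mono g \<and> g \<sim>\<^sub>g f}"

definition dist_from_set :: "('v, 'e) pre_digraph \<Rightarrow> 'v set \<Rightarrow> 'v \<Rightarrow> nat" where
  "dist_from_set \<Gamma> A y = Min ((\<lambda>a. graph_dist \<Gamma> a y) ` A)"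

definition growth_fun :: "('v, 'e) pre_digraph \<Rightarrow> 'v set \<Rightarrow> 'v set \<Rightarrow> nat \<Rightarrow> nat" where
  "growth_fun \<Gamma> Y A n = card {y \<in> Y. dist_from_set \<Gamma> A y \<le> n}"

text \<open>
  By the triangle inequality the class does not depend on \<open>A\<close>, so the union is over copies of
  a single class. For \<open>Y = {}\<close>, where no \<open>A\<close> exists, it is empty and hence differs from the
  growth of every nonempty set.
\<close>

definition Growth :: "('v, 'e) pre_digraph \<Rightarrow> 'v set \<Rightarrow> (nat \<Rightarrow> nat) set" where
  "Growth \<Gamma> Y = (\<Union>A \<in> {A. finite A \<and> A \<noteq> {} \<and> A \<subseteq> Y}. growth_class (growth_fun \<Gamma> Y A))"

definition polynomial_growth_of_degree :: "('a, 'm) monoid_scheme \<Rightarrow> nat \<Rightarrow> bool" where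
  "polynomial_growth_of_degree G d \<longleftrightarrow>
     (\<exists>T. finite_generating_set G T \<and>
          Growth (cayley_graph G T) (carrier G) = growth_class (\<lambda>n. n ^ d))"


section \<open>The fire game\<close>

definition strategy :: "('v, 'e) pre_digraph \<Rightarrow> (nat \<Rightarrow> nat) \<Rightarrow> (nat \<Rightarrow> 'v set) \<Rightarrow> bool" where
  "strategy \<Gamma> f W \<longleftrightarrow> (\<forall>n\<ge>1. W n \<subseteq> verts \<Gamma> \<and> finite (W n) \<and> card (W n) \<le> f n)"

primrec fire :: "('v, 'e) pre_digraph \<Rightarrow> (nat \<Rightarrow> 'v set) \<Rightarrow> 'v set \<Rightarrow> nat \<Rightarrow> 'v set" where
  "fire \<Gamma> W X0 0 = X0"
| "fire \<Gamma> W X0 (Suc n) =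
     {v. \<exists>p. vwalk p \<Gamma> \<and> hd p \<in> fire \<Gamma> W X0 n \<and> last p = v \<and> vwalk_length p \<le> 1
           \<and> set p \<inter> ((\<Union>i\<in>{1..Suc n}. W i) - fire \<Gamma> W X0 n) = {}}"

definition retaining :: "('v, 'e) pre_digraph \<Rightarrow> (nat \<Rightarrow> 'v set) \<Rightarrow> 'v set \<Rightarrow> bool" where
  "retaining \<Gamma> W X0 \<longleftrightarrow>
     Growth \<Gamma> (verts \<Gamma> - (\<Union>n. fire \<Gamma> W X0 n)) = Growth \<Gamma> (verts \<Gamma>)"

definition polynomial_retaining_property :: "('v, 'e) pre_digraph \<Rightarrow> nat \<Rightarrow> bool" where
  "polynomial_retaining_property \<Gamma> e \<longleftrightarrow>
     (\<exists>K>0. \<forall>X0. finite X0 \<and> X0 \<subseteq> verts \<Gamma> \<longrightarrow>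
        (\<exists>W. strategy \<Gamma> (\<lambda>n. K * n ^ e) W \<and> retaining \<Gamma> W X0))"

end

theory Submission
  imports Defs
begin

text \<open>
  The group acts on the Bass--Serre tree of the splitting, whose edges are the cosets of \<open>C\<close>. The
  elements of \<open>G\<close> moving the base vertex across a fixed edge form a half-space: its boundary in the
  Cayley graph lies in finitely many translates of \<open>C\<close>, it grows like \<open>G\<close>, and it has translates
  arbitrarily far from any finite set. Given an initial fire, choose such a distant translate and
  protect its boundary in order of distance from the fire: since \<open>C\<close> is quasi-isometrically embedded,
  at most \<open>O(n\<^sup>d)\<close> boundary points have to be protected by time \<open>n\<close>, which a budget of order
  \<open>n\<^sup>d\<^sup>-\<^sup>1\<close> allows, so the translate never burns.

  Normal forms are avoided. The set of edges between the base vertex and its image under \<open>x\<close> is a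
  cocycle in \<open>x\<close>, so the universal property of the presentation produces it, and the few facts about
  geodesics that are needed follow from the cocycle identity by induction on words.
\<close>

section \<open>Cocycles from presentations\<close>

text \<open>The difficulty is uniformity. The rate \<open>K * n ^ (d - 1)\<close> is fixed before
  the initial fire is known, yet the protected translate must lie arbitrarily far from that fire.
  Two facts reconcile this. The number of points of \<open>q C f\<close> in a ball is bounded
  independently of \<open>q\<close>. Moreover, if the fire starts inside radius \<open>r\<close> and
  the translate misses the ball of radius \<open>2 * r\<close>, then nothing has to be protected up
  to time \<open>r\<close>, and afterwards every boundary point within \<open>n\<close> of the fire
  has length at most \<open>2 * n\<close>.

  That the half-space \<open>H\<close> grows like \<open>G\<close> is obtained from a covering: each
  \<open>x\<close> in \<open>G\<close> has \<open>f \<otimes> x\<close> or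
  \<open>f \<otimes> inv x\<close> in \<open>H\<close> for some \<open>f\<close> in a fixed finite
  set. Left translation shifts radii by a bounded amount and inversion preserves balls about
  \<open>\<one>\<close>.\<close>

lemma word_congruence_lists:
  assumes "(u, v) \<in> word_congruence X R"
  shows "u \<in> lists X \<and> v \<in> lists X"
  using assms
proof induction
  case (rel u v x y)
  then show ?case by (simp add: append_in_lists_conv)
qed auto

lemma equiv_word_congruence: "equiv (lists X) (word_congruence X R)"
proof (rule equivI)
  show "refl_on (lists X) (word_congruence X R)"
    by (auto intro!: refl_onI word_congruence.refl)
  show "word_congruence X R \<subseteq> lists X \<times> lists X"
    using word_congruence_lists by fast
  show "sym (word_congruence X R)"
    by (auto intro: symI word_congruence.sym)
  show "trans (word_congruence X R)"
    by (blast intro: transI word_congruence.trans)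
qed

lemma word_congruence_context:
  assumes "(u, v) \<in> word_congruence X R" and "x \<in> lists X" "y \<in> lists X"
  shows "(x @ u @ y, x @ v @ y) \<in> word_congruence X R"
  using assms
proof induction
  case (refl u)
  then show ?case by (simp add: append_in_lists_conv word_congruence.refl)
next
  case (rel u v x' y')
  then have "(((x @ x') @ u @ (y' @ y)), ((x @ x') @ v @ (y' @ y))) \<in> word_congruence X R"
    by (intro word_congruence.rel) (auto simp: append_in_lists_conv)
  then show ?case by simp
qed (blast intro: word_congruence.sym word_congruence.trans)+

lemma word_congruence_append:
  assumes "(u, u') \<in> word_congruence X R" "(v, v') \<in> word_congruence X R"
  shows "(u @ v, u' @ v') \<in> word_congruence X R"
proof -
  have "(u @ v, u' @ v) \<in> word_congruence X R"
    using word_congruence_context[OF assms(1), of "[]" v] word_congruence_lists[OF assms(2)] by simp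
  moreover have "(u' @ v, u' @ v') \<in> word_congruence X R"
    using word_congruence_context[OF assms(2), of u' "[]"] word_congruence_lists[OF assms(1)] by simp
  ultimately show ?thesis by (rule word_congruence.trans)
qed

lemma word_class_eq_iff:
  assumes "u \<in> lists X" "v \<in> lists X"
  shows "word_class X R u = word_class X R v \<longleftrightarrow> (u, v) \<in> word_congruence X R"
  unfolding word_class_def by (rule eq_equiv_class_iff[OF equiv_word_congruence assms])

lemma word_class_in_carrier:
  "u \<in> lists X \<Longrightarrow> word_class X R u \<in> carrier (presented_monoid X R)"
  by (simp add: presented_monoid_def word_class_def quotientI)

lemma word_class_mult:
  assumes "u \<in> lists X" "v \<in> lists X"
  shows "word_class X R u \<otimes>\<^bsub>presented_monoid X R\<^esub> word_class X R v = word_class X R (u @ v)"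
proof -
  have "word_class X R (u' @ v') = word_class X R (u @ v)"
    if "u' \<in> word_class X R u" "v' \<in> word_class X R v" for u' v'
  proof -
    have "(u @ v, u' @ v') \<in> word_congruence X R"
      using that by (intro word_congruence_append) (auto simp: word_class_def)
    then have "(u' @ v', u @ v) \<in> word_congruence X R" by (rule word_congruence.sym)
    then show ?thesis
      using word_class_eq_iff[of "u' @ v'" X "u @ v" R] word_congruence_lists by blast
  qed
  moreover have "u \<in> word_class X R u" "v \<in> word_class X R v"
    using assms by (auto simp: word_class_def word_congruence.refl)
  ultimately have "(\<Union>u'\<in>word_class X R u. \<Union>v'\<in>word_class X R v. word_class X R (u' @ v'))
      = word_class X R (u @ v)"
    by blast
  then show ?thesis by (simp add: presented_monoid_def)
qed

section \<open>Derivations on words and their descent to the group\<close>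

context group begin

lemma inv_mult_cancel [simp]:
  "\<lbrakk>x \<in> carrier G; y \<in> carrier G\<rbrakk> \<Longrightarrow> inv x \<otimes> (x \<otimes> y) = y"
  "\<lbrakk>x \<in> carrier G; y \<in> carrier G\<rbrakk> \<Longrightarrow> x \<otimes> (inv x \<otimes> y) = y"
  by (simp_all flip: m_assoc)

primrec word_val :: "('x \<Rightarrow> 'a) \<Rightarrow> 'x list \<Rightarrow> 'a" where
  "word_val val [] = \<one>"
| "word_val val (l # w) = val l \<otimes> word_val val w"

text \<open>
  A subset of \<open>G\<close> is encoded by its characteristic function, so that symmetric difference is
  \<open>\<noteq>\<close> on \<^typ>\<open>bool\<close>. This is the derivation (with values in subsets of \<open>G\<close>, on which \<open>G\<close>
  acts by left translation) prescribed by \<open>p\<close> on the letters.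
\<close>

primrec word_deriv :: "('x \<Rightarrow> 'a) \<Rightarrow> ('x \<Rightarrow> 'a \<Rightarrow> bool) \<Rightarrow> 'x list \<Rightarrow> 'a \<Rightarrow> bool" where
  "word_deriv val p [] g = False"
| "word_deriv val p (l # w) g = (p l g \<noteq> word_deriv val p w (inv (val l) \<otimes> g))"

lemma word_val_closed:
  "\<lbrakk>val ` X \<subseteq> carrier G; w \<in> lists X\<rbrakk> \<Longrightarrow> word_val val w \<in> carrier G"
  by (induction w) auto

lemma word_val_append:
  "\<lbrakk>val ` X \<subseteq> carrier G; u \<in> lists X; v \<in> lists X\<rbrakk>
    \<Longrightarrow> word_val val (u @ v) = word_val val u \<otimes> word_val val v"
proof (induction u)
  case (Cons l u)
  then have "val l \<in> carrier G" "word_val val u \<in> carrier G" "word_val val v \<in> carrier G"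
    using word_val_closed[of val X] by auto
  with Cons show ?case by (simp add: m_assoc)
qed (simp add: word_val_closed)

text \<open>The Leibniz rule: the second word contributes after translation by the value of the
  first.\<close>

lemma word_deriv_append:
  assumes "val ` X \<subseteq> carrier G" "u \<in> lists X" "v \<in> lists X" "g \<in> carrier G"
  shows "word_deriv val p (u @ v) g
    = (word_deriv val p u g \<noteq> word_deriv val p v (inv (word_val val u) \<otimes> g))"
  using assms
proof (induction u arbitrary: g)
  case (Cons l u)
  then have "val l \<in> carrier G" "word_val val u \<in> carrier G"
    using word_val_closed[of val X u] by auto
  with Cons show ?case by (auto simp: inv_mult_group m_assoc)
qed simp

text \<open>Since \<open>h\<close> is injective, two words have the same value exactly when they are
  congruent. A word derivation that respects the relations therefore depends on the value alone and
  descends to \<open>G\<close>. The other conclusions do not involve \<open>p\<close>: they transfer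
  relations to \<open>G\<close> and give induction over letters.\<close>

lemma presentation_cocycle:
  assumes h: "h \<in> iso (presented_monoid X R) G"
    and val: "\<forall>l\<in>X. val l = h (word_class X R [l])"
    and rels: "\<forall>(u, v)\<in>R. u \<in> lists X \<longrightarrow> v \<in> lists X
      \<longrightarrow> (\<forall>g\<in>carrier G. word_deriv val p u g = word_deriv val p v g)"
  shows "\<exists>E. (\<forall>x\<in>carrier G. \<forall>y\<in>carrier G. \<forall>g\<in>carrier G. E (x \<otimes> y) g = (E x g \<noteq> E y (inv x \<otimes> g)))
      \<and> (\<forall>l\<in>X. \<forall>g\<in>carrier G. E (val l) g = p l g)"
    and "\<And>u v. \<lbrakk>(u, v) \<in> R; u \<in> lists X; v \<in> lists X\<rbrakk> \<Longrightarrow> word_val val u = word_val val v"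
    and "val ` X \<subseteq> carrier G"
    and "\<And>Q x. \<lbrakk>Q \<one>; \<And>x l. \<lbrakk>x \<in> carrier G; l \<in> X; Q x\<rbrakk> \<Longrightarrow> Q (x \<otimes> val l); x \<in> carrier G\<rbrakk> \<Longrightarrow> Q x"
proof -
  have val: "val l = h (word_class X R [l])" if "l \<in> X" for l
    using val that by simp
  have rels: "word_deriv val p u g = word_deriv val p v g"
    if "(u, v) \<in> R" "u \<in> lists X" "v \<in> lists X" "g \<in> carrier G" for u v g
    using bspec[OF rels that(1)] that(2-4) by simp
  let ?M = "presented_monoid X R" and ?cls = "word_class X R"
  have hhom: "h (a \<otimes>\<^bsub>?M\<^esub> b) = h a \<otimes> h b" if "a \<in> carrier ?M" "b \<in> carrier ?M" for a b
    using h that by (auto simp: iso_def hom_def)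
  have hcarr: "h a \<in> carrier G" if "a \<in> carrier ?M" for a
    using h that by (auto simp: iso_def hom_def)
  have hinj: "inj_on h (carrier ?M)" and himg: "h ` carrier ?M = carrier G"
    using h by (auto simp: iso_def bij_betw_def)
  show valX: "val ` X \<subseteq> carrier G"
  proof (rule image_subsetI)
    fix l assume "l \<in> X"
    then have "?cls [l] \<in> carrier ?M" by (intro word_class_in_carrier) simp
    then show "val l \<in> carrier G" using hcarr val[OF \<open>l \<in> X\<close>] by simp
  qed
  \<comment> \<open>\<open>iso\<close> records multiplicativity only; the class of the empty word is
    idempotent, so its image is \<open>\<one>\<close>.\<close>
  have nil: "h (?cls []) = \<one>"
  proof -
    have c: "?cls [] \<in> carrier ?M" by (simp add: word_class_in_carrier)
    have "h (?cls []) \<otimes> h (?cls []) = h (?cls [] \<otimes>\<^bsub>?M\<^esub> ?cls [])"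
      by (rule hhom[OF c c, symmetric])
    also have "?cls [] \<otimes>\<^bsub>?M\<^esub> ?cls [] = ?cls []"
      using word_class_mult[of "[]" X "[]" R] by simp
    finally show ?thesis using r_cancel_one[OF hcarr[OF c] hcarr[OF c]] by simp
  qed
  have hval: "h (?cls w) = word_val val w" if "w \<in> lists X" for w
    using that
  proof (induction w)
    case (Cons l w)
    then have "h (?cls ([l] @ w)) = h (?cls [l]) \<otimes> h (?cls w)"
      using hhom[of "?cls [l]" "?cls w"] by (simp add: word_class_mult word_class_in_carrier)
    with Cons val show ?case by simp
  qed (simp add: nil)
  have val_iff: "word_val val u = word_val val v \<longleftrightarrow> (u, v) \<in> word_congruence X R"
    if "u \<in> lists X" "v \<in> lists X" for u v
    using inj_on_eq_iff[OF hinj, of "?cls u" "?cls v"] word_class_in_carrier[OF that(1)]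
      word_class_in_carrier[OF that(2)] hval[OF that(1)] hval[OF that(2)]
      word_class_eq_iff[OF that] by simp
  show "word_val val u = word_val val v" if "(u, v) \<in> R" "u \<in> lists X" "v \<in> lists X" for u v
    using val_iff word_congruence.rel[OF that, of "[]" "[]"] that by simp
  have ex: "\<exists>w\<in>lists X. word_val val w = x" if "x \<in> carrier G" for x
  proof -
    have "x \<in> h ` carrier ?M" using that himg by simp
    then obtain a where a: "a \<in> carrier ?M" "x = h a" by (elim imageE)
    then have "a \<in> lists X // word_congruence X R" by (simp add: presented_monoid_def)
    then obtain w where w: "w \<in> lists X" "a = ?cls w"
      unfolding word_class_def by (rule quotientE)
    have "word_val val w = x" using a(2) w(2) hval[OF w(1)] by simp
    with w(1) show ?thesis by (rule bexI[rotated])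
  qed
  have deriv_cong: "word_deriv val p u g = word_deriv val p v g"
    if "(u, v) \<in> word_congruence X R" "g \<in> carrier G" for u v g
    using that
  proof (induction arbitrary: g)
    case (sym u v)
    then show ?case by metis
  next
    case (trans u v w)
    then show ?case by metis
  next
    case (rel u v x y)
    \<comment> \<open>In a context, the derivation of the tail \<open>y\<close> is translated by the
      value of what precedes it, so equal derivations of \<open>u\<close> and \<open>v\<close> do
      not suffice; their values must agree too.\<close>
    have "word_val val u = word_val val v"
      using val_iff word_congruence.rel[OF rel(1-3), of "[]" "[]"] rel by simp
    moreover have "word_val val x \<in> carrier G" "word_val val u \<in> carrier G"
      using rel word_val_closed[OF valX] by auto
    ultimately show ?case
      using rel rels[OF rel(1-3)] by (simp add: word_deriv_append[OF valX] append_in_lists_conv)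
  qed (rule HOL.refl)
  define wd where "wd x = (SOME w. w \<in> lists X \<and> word_val val w = x)" for x
  have wd: "wd x \<in> lists X" "word_val val (wd x) = x" if "x \<in> carrier G" for x
    using someI_ex[of "\<lambda>w. w \<in> lists X \<and> word_val val w = x"] ex[OF that] unfolding wd_def by auto
  define E where "E x = word_deriv val p (wd x)" for x
  have E_val: "E (word_val val w) g = word_deriv val p w g" if "w \<in> lists X" "g \<in> carrier G" for w g
  proof -
    note w = wd[OF word_val_closed[OF valX that(1)]]
    show ?thesis
      unfolding E_def using val_iff[OF w(1) that(1)] w(2) by (intro deriv_cong that(2)) simp
  qed
  have "E (x \<otimes> y) g = (E x g \<noteq> E y (inv x \<otimes> g))"
    if "x \<in> carrier G" "y \<in> carrier G" "g \<in> carrier G" for x y g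
  proof -
    have "E (word_val val (wd x @ wd y)) g = (E x g \<noteq> E y (inv x \<otimes> g))"
      using that wd by (subst E_val) (auto simp: E_def word_deriv_append[OF valX] append_in_lists_conv)
    then show ?thesis using that wd word_val_append[OF valX] by simp
  qed
  moreover have "E (val l) g = p l g" if "l \<in> X" "g \<in> carrier G" for l g
    using E_val[of "[l]" g] that valX by (auto simp: image_subset_iff)
  ultimately show "\<exists>E. (\<forall>x\<in>carrier G. \<forall>y\<in>carrier G. \<forall>g\<in>carrier G. E (x \<otimes> y) g = (E x g \<noteq> E y (inv x \<otimes> g)))
      \<and> (\<forall>l\<in>X. \<forall>g\<in>carrier G. E (val l) g = p l g)"
    by (intro exI[of _ E] conjI ballI)
  show "Q x" if Q1: "Q \<one>" and Qs: "\<And>x l. \<lbrakk>x \<in> carrier G; l \<in> X; Q x\<rbrakk> \<Longrightarrow> Q (x \<otimes> val l)"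
    and x: "x \<in> carrier G" for Q x
  proof -
    have "Q (word_val val w)" if "w \<in> lists X" for w
      using that
    proof (induction w rule: rev_induct)
      case (snoc l w)
      moreover have "val l \<in> carrier G" using snoc valX by auto
      ultimately show ?case
        using Qs[of "word_val val w" l] word_val_append[OF valX, of w "[l]"] word_val_closed[OF valX]
        by simp
    qed (simp add: Q1)
    moreover obtain w where "w \<in> lists X" "word_val val w = x" using ex[OF x] by (elim bexE)
    ultimately show ?thesis by metis
  qed
qed

end

section \<open>Half-spaces\<close>

text \<open>Quantifying over every \<open>s\<close> in \<open>G\<close> keeps the notion independent
  of a generating set. The right factors \<open>F'\<close> come from the finitely many edges crossed
  by \<open>s\<close>; the left factors \<open>F\<close> leave room for replacing the edge group by
  a conjugate.\<close>

definition (in group) coset_boundary :: "'a set \<Rightarrow> 'a set \<Rightarrow> bool" where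
  "coset_boundary C H \<longleftrightarrow> (\<forall>s\<in>carrier G. \<exists>F F'. finite F \<and> finite F' \<and> F \<subseteq> carrier G \<and> F' \<subseteq> carrier G
    \<and> (\<forall>x\<in>H. x \<otimes> s \<notin> H \<longrightarrow> (\<exists>f\<in>F. \<exists>c\<in>C. \<exists>f'\<in>F'. x = f \<otimes> c \<otimes> f')))"

text \<open>The covering clause encodes that \<open>H\<close> grows like \<open>G\<close>; in the
  last clause the translate of \<open>H\<close> by \<open>inv g\<close> is the one that misses
  \<open>X\<close>.\<close>

definition (in group) half_space :: "'a set \<Rightarrow> 'a set \<Rightarrow> bool" where
  "half_space C H \<longleftrightarrow> H \<subseteq> carrier G \<and> coset_boundary C H
    \<and> (\<exists>F. finite F \<and> F \<subseteq> carrier G \<and> (\<forall>x\<in>carrier G. \<exists>f\<in>F. f \<otimes> x \<in> H \<or> f \<otimes> inv x \<in> H))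
    \<and> (\<forall>X. finite X \<and> X \<subseteq> carrier G \<longrightarrow> (\<exists>g\<in>carrier G. \<forall>x\<in>X. g \<otimes> x \<notin> H))"

text \<open>Rewriting \<open>f a f'\<close> as \<open>(f t) (inv t a t) (inv t f')\<close> absorbs
  the conjugation into the outer factors.\<close>

lemma (in group) coset_boundary_conjugate:
  assumes bd: "coset_boundary A H" and t: "t \<in> carrier G"
    and A: "\<And>a. a \<in> A \<Longrightarrow> a \<in> carrier G \<and> inv t \<otimes> a \<otimes> t \<in> C"
  shows "coset_boundary C H"
  unfolding coset_boundary_def
proof
  fix s assume "s \<in> carrier G"
  obtain F F' where F: "finite F" "finite F'" "F \<subseteq> carrier G" "F' \<subseteq> carrier G"
    and bd: "\<forall>x\<in>H. x \<otimes> s \<notin> H \<longrightarrow> (\<exists>f\<in>F. \<exists>a\<in>A. \<exists>f'\<in>F'. x = f \<otimes> a \<otimes> f')"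
    using bspec[OF bd[unfolded coset_boundary_def] \<open>s \<in> carrier G\<close>] by (elim exE conjE) (rule that)
  show "\<exists>F F'. finite F \<and> finite F' \<and> F \<subseteq> carrier G \<and> F' \<subseteq> carrier G
      \<and> (\<forall>x\<in>H. x \<otimes> s \<notin> H \<longrightarrow> (\<exists>f\<in>F. \<exists>c\<in>C. \<exists>f'\<in>F'. x = f \<otimes> c \<otimes> f'))"
  proof (rule exI[of _ "(\<lambda>f. f \<otimes> t) ` F"], rule exI[of _ "(\<lambda>f. inv t \<otimes> f) ` F'"], intro conjI ballI impI)
    fix x assume "x \<in> H" "x \<otimes> s \<notin> H"
    then have "\<exists>f\<in>F. \<exists>a\<in>A. \<exists>f'\<in>F'. x = f \<otimes> a \<otimes> f'" using bd by simp
    then obtain f a f' where x: "f \<in> F" "a \<in> A" "f' \<in> F'" "x = f \<otimes> a \<otimes> f'" by (elim bexE)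
    have "f \<in> carrier G" "f' \<in> carrier G" "a \<in> carrier G" using x F A by auto
    then have "x = (f \<otimes> t) \<otimes> (inv t \<otimes> a \<otimes> t) \<otimes> (inv t \<otimes> f')"
      using x(4) t by (simp add: m_assoc)
    moreover have "inv t \<otimes> a \<otimes> t \<in> C" using x A by simp
    ultimately show "\<exists>f\<in>(\<lambda>f. f \<otimes> t) ` F. \<exists>c\<in>C. \<exists>f'\<in>(\<lambda>f. inv t \<otimes> f) ` F'. x = f \<otimes> c \<otimes> f'"
      using x(1,3) by (intro bexI[of _ "f \<otimes> t"] bexI[of _ "inv t \<otimes> a \<otimes> t"] bexI[of _ "inv t \<otimes> f'"] imageI)
  qed (use F t in auto)
qed

context group begin

lemma subgroup_inv_iff: "\<lbrakk>subgroup K G; y \<in> carrier G\<rbrakk> \<Longrightarrow> inv y \<in> K \<longleftrightarrow> y \<in> K"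
  using subgroup.m_inv_closed[of K G y] subgroup.m_inv_closed[of K G "inv y"] inv_inv[of y] by metis

lemma subgroup_mult_left_iff:
  assumes "subgroup K G" "k \<in> K" "y \<in> carrier G"
  shows "k \<otimes> y \<in> K \<longleftrightarrow> y \<in> K"
proof
  have k: "k \<in> carrier G" using subgroup.mem_carrier[OF assms(1,2)] .
  assume "k \<otimes> y \<in> K"
  then have "inv k \<otimes> (k \<otimes> y) \<in> K"
    by (rule subgroup.m_closed[OF assms(1) subgroup.m_inv_closed[OF assms(1,2)]])
  then show "y \<in> K" using k assms(3) by simp
qed (rule subgroup.m_closed[OF assms(1,2)])

lemma subgroup_mult_right_iff:
  assumes "subgroup K G" "k \<in> K" "y \<in> carrier G"
  shows "y \<otimes> k \<in> K \<longleftrightarrow> y \<in> K"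
  using subgroup_mult_left_iff[OF assms(1), of "inv k" "inv y"] assms subgroup.mem_carrier[OF assms(1,2)]
    subgroup_inv_iff[OF assms(1), of "y \<otimes> k"]
  by (simp add: subgroup_inv_iff inv_mult_group)

end

text \<open>
  In Bass--Serre terms, \<open>E x g\<close> says that the edge \<open>gC\<close> of the tree lies on the geodesic from the
  base vertex to its image under \<open>x\<close>. The letters \<open>Y\<close> are those of the presentation.
\<close>

locale edge_cocycle = group G for G :: "('a, 'm) monoid_scheme" (structure) +
  fixes C :: "'a set" and E :: "'a \<Rightarrow> 'a \<Rightarrow> bool" and Y :: "'a set"
  assumes subgroup_C: "subgroup C G"
    and cocycle: "\<lbrakk>x \<in> carrier G; y \<in> carrier G; g \<in> carrier G\<rbrakk>
      \<Longrightarrow> E (x \<otimes> y) g = (E x g \<noteq> E y (inv x \<otimes> g))"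
    and letters: "Y \<subseteq> carrier G"
    and letter_induct [consumes 1, case_names one step]:
      "\<lbrakk>x \<in> carrier G; Q \<one>; \<And>x s. \<lbrakk>x \<in> carrier G; s \<in> Y; Q x\<rbrakk> \<Longrightarrow> Q (x \<otimes> s)\<rbrakk> \<Longrightarrow> Q x"
    and letter_finite: "s \<in> Y \<Longrightarrow> \<exists>F. finite F \<and> F \<subseteq> carrier G
      \<and> (\<forall>g\<in>carrier G. E s g \<longrightarrow> (\<exists>f\<in>F. \<exists>c\<in>C. g = f \<otimes> c))"
begin

lemma C_carrier: "c \<in> C \<Longrightarrow> c \<in> carrier G"
  using subgroup.mem_carrier[OF subgroup_C] .

lemma E_one: "g \<in> carrier G \<Longrightarrow> \<not> E \<one> g"
  using cocycle[of \<one> \<one> g] by auto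

lemma E_inv:
  assumes "x \<in> carrier G" "g \<in> carrier G"
  shows "E (inv x) g = E x (x \<otimes> g)"
  using cocycle[of x "inv x" "x \<otimes> g"] E_one[of "x \<otimes> g"] assms by auto

text \<open>A geodesic has finitely many edges: those of \<open>x \<otimes> s\<close> occur among
  the edges of \<open>x\<close> and the \<open>x\<close>-translates of the edges of
  \<open>s\<close>, so finiteness passes from letters to words.\<close>

lemma finite_cosets:
  assumes "x \<in> carrier G"
  shows "\<exists>F. finite F \<and> F \<subseteq> carrier G \<and> (\<forall>g\<in>carrier G. E x g \<longrightarrow> (\<exists>f\<in>F. \<exists>c\<in>C. g = f \<otimes> c))"
  using assms
proof (induction rule: letter_induct)
  case one
  then show ?case using E_one by (intro exI[of _ "{}"]) auto
next
  case (step x s)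
  have s: "s \<in> carrier G" using step letters by auto
  obtain F where F: "finite F" "F \<subseteq> carrier G" "\<forall>g\<in>carrier G. E x g \<longrightarrow> (\<exists>f\<in>F. \<exists>c\<in>C. g = f \<otimes> c)"
    using step(3) by (elim exE conjE)
  obtain F' where F': "finite F'" "F' \<subseteq> carrier G"
      "\<forall>g\<in>carrier G. E s g \<longrightarrow> (\<exists>f\<in>F'. \<exists>c\<in>C. g = f \<otimes> c)"
    using letter_finite[OF \<open>s \<in> Y\<close>] by (elim exE conjE)
  show ?case
  proof (intro exI[of _ "F \<union> (\<lambda>f. x \<otimes> f) ` F'"] conjI ballI impI)
    fix g assume g: "g \<in> carrier G" "E (x \<otimes> s) g"
    show "\<exists>f \<in> F \<union> (\<lambda>f. x \<otimes> f) ` F'. \<exists>c\<in>C. g = f \<otimes> c"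
    proof (cases "E x g")
      case True
      then have "\<exists>f\<in>F. \<exists>c\<in>C. g = f \<otimes> c" using F(3) g(1) by simp
      then show ?thesis by (elim bexE) (intro bexI, auto)
    next
      case False
      then have "E s (inv x \<otimes> g)" using cocycle[of x s g] g step(1) s by simp
      then have "\<exists>f\<in>F'. \<exists>c\<in>C. inv x \<otimes> g = f \<otimes> c" using F'(3) g(1) step(1) by simp
      then obtain f c where fc: "f \<in> F'" "c \<in> C" "inv x \<otimes> g = f \<otimes> c" by (elim bexE)
      have "f \<in> carrier G" "c \<in> carrier G" using fc F'(2) C_carrier by auto
      moreover have "g = x \<otimes> (f \<otimes> c)" unfolding fc(3)[symmetric] using g step(1) by simp
      ultimately have "g = (x \<otimes> f) \<otimes> c" using step(1) by (simp add: m_assoc)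
      then show ?thesis using fc(1,2) by (intro bexI[of _ "x \<otimes> f"] bexI[of _ c]) auto
    qed
  qed (use F F' step(1) in auto)
qed

text \<open>The step from \<open>x\<close> to \<open>x \<otimes> s\<close> changes the side of the
  edge \<open>C\<close> exactly when \<open>s\<close> crosses the edge of \<open>inv x\<close>. Then
  \<open>inv x\<close> lies in one of finitely many cosets \<open>f C\<close>, and inversion puts
  \<open>x\<close> into \<open>C (inv f)\<close>.\<close>

lemma coset_boundary_cocycle: "coset_boundary C {x \<in> carrier G. E x \<one>}"
  unfolding coset_boundary_def
proof
  fix s assume s: "s \<in> carrier G"
  obtain F where F: "finite F" "F \<subseteq> carrier G"
    and Fs: "\<forall>g\<in>carrier G. E s g \<longrightarrow> (\<exists>f\<in>F. \<exists>c\<in>C. g = f \<otimes> c)"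
    using finite_cosets[OF s] by (elim exE conjE)
  show "\<exists>F F'. finite F \<and> finite F' \<and> F \<subseteq> carrier G \<and> F' \<subseteq> carrier G
      \<and> (\<forall>x\<in>{x \<in> carrier G. E x \<one>}. x \<otimes> s \<notin> {x \<in> carrier G. E x \<one>} \<longrightarrow>
          (\<exists>f\<in>F. \<exists>c\<in>C. \<exists>f'\<in>F'. x = f \<otimes> c \<otimes> f'))"
  proof (rule exI[of _ "{\<one>}"], rule exI[of _ "(\<lambda>f. inv f) ` F"], intro conjI ballI impI)
    fix x assume x: "x \<in> {x \<in> carrier G. E x \<one>}" "x \<otimes> s \<notin> {x \<in> carrier G. E x \<one>}"
    then have "E s (inv x)" using cocycle[of x s \<one>] s by auto
    then have "\<exists>f\<in>F. \<exists>c\<in>C. inv x = f \<otimes> c" using Fs x by simp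
    then obtain f c where fc: "f \<in> F" "c \<in> C" "inv x = f \<otimes> c" by (elim bexE)
    have cc: "c \<in> carrier G" "f \<in> carrier G" using fc C_carrier F by auto
    have "x = inv (inv x)" using x by simp
    also have "\<dots> = inv c \<otimes> inv f" unfolding fc(3) using cc by (simp add: inv_mult_group)
    finally have "x = \<one> \<otimes> inv c \<otimes> inv f" using cc by simp
    moreover have "inv c \<in> C" using fc subgroup.m_inv_closed[OF subgroup_C] by simp
    ultimately show "\<exists>f\<in>{\<one>}. \<exists>c\<in>C. \<exists>f'\<in>(\<lambda>f. inv f) ` F. x = f \<otimes> c \<otimes> f'"
      using fc(1) by (intro bexI[of _ \<one>] bexI[of _ "inv c"] bexI[of _ "inv f"]) auto
  qed (use F in auto)
qed

text \<open>
  If every translate by a power of \<open>t\<close> met a finite set, infinitely many \<open>t\<^sup>n\<close> would be edges of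
  finitely many geodesics, so some \<open>t\<^sup>k\<close> would lie in \<open>C\<close>.
\<close>

lemma escape:
  assumes t: "t \<in> carrier G" and Et: "E t \<one>"
    and nest: "\<And>x. \<lbrakk>x \<in> carrier G; E x \<one>\<rbrakk> \<Longrightarrow> E (t \<otimes> x) \<one>"
    and EC: "\<And>c. c \<in> C \<Longrightarrow> \<not> E c \<one>"
    and X: "finite X \<and> X \<subseteq> carrier G"
  shows "\<exists>g\<in>carrier G. \<forall>x\<in>X. g \<otimes> x \<notin> {x \<in> carrier G. E x \<one>}"
proof -
  have pow: "E (t [^] Suc n) \<one>" for n :: nat
  proof (induction n)
    case (Suc n)
    then have "E (t \<otimes> t [^] Suc n) \<one>" using nest t by simp
    then show ?case using nat_pow_Suc2[OF t, of "Suc n"] by simp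
  qed (use t Et in simp)
  have iter: "E (t [^] n \<otimes> x) \<one>" if "x \<in> carrier G" "E x \<one>" for x and n :: nat
  proof (induction n)
    case (Suc n)
    then have "E (t \<otimes> (t [^] n \<otimes> x)) \<one>" using nest t that by simp
    then show ?case using nat_pow_Suc2[OF t, of n] that t by (simp add: m_assoc)
  qed (use that in simp)
  show "\<exists>g\<in>carrier G. \<forall>x\<in>X. g \<otimes> x \<notin> {x \<in> carrier G. E x \<one>}"
  proof (rule ccontr)
    assume contra: "\<not> ?thesis"
    have "\<exists>F. \<forall>x\<in>X. finite (F x) \<and> F x \<subseteq> carrier G
        \<and> (\<forall>g\<in>carrier G. E x g \<longrightarrow> (\<exists>f\<in>F x. \<exists>c\<in>C. g = f \<otimes> c))"
      using finite_cosets X by (intro bchoice) auto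
    then obtain F where FX: "\<forall>x\<in>X. finite (F x) \<and> F x \<subseteq> carrier G
        \<and> (\<forall>g\<in>carrier G. E x g \<longrightarrow> (\<exists>f\<in>F x. \<exists>c\<in>C. g = f \<otimes> c))"
      by (elim exE)
    have F: "finite (F x) \<and> F x \<subseteq> carrier G" if "x \<in> X" for x
      using bspec[OF FX that] by (elim conjE) (intro conjI)
    have Fx: "\<exists>f\<in>F x. \<exists>c\<in>C. g = f \<otimes> c" if "x \<in> X" "g \<in> carrier G" "E x g" for x g
      using bspec[OF FX that(1)] that by simp
    have "\<exists>f. f \<in> (\<Union>x\<in>X. F x) \<and> (\<exists>c\<in>C. t [^] n = f \<otimes> c)" for n :: nat
    proof -
      have tn: "t [^] n \<in> carrier G" using t by simp
      then have "\<not> (\<forall>x\<in>X. inv (t [^] n) \<otimes> x \<notin> {x \<in> carrier G. E x \<one>})"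
        using contra inv_closed by (simp only: bex_simps) simp
      then obtain x where x: "x \<in> X" "E (inv (t [^] n) \<otimes> x) \<one>" by auto
      \<comment> \<open>Otherwise \<open>iter\<close> would put \<open>\<one>\<close> itself into
        the half-space.\<close>
      have "\<not> E (inv (t [^] n)) \<one>"
        using iter[of "inv (t [^] n)" n] E_one[of \<one>] tn by auto
      then have "E x (t [^] n)"
        using cocycle[of "inv (t [^] n)" x \<one>] x X tn by auto
      then have "\<exists>f\<in>F x. \<exists>c\<in>C. t [^] n = f \<otimes> c" using Fx[OF x(1) tn] by simp
      then obtain f where "f \<in> F x" "\<exists>c\<in>C. t [^] n = f \<otimes> c" by (rule bexE)
      then show ?thesis using x(1) by (intro exI[of _ f] conjI UN_I)
    qed
    then have "\<forall>n :: nat. \<exists>f. f \<in> (\<Union>x\<in>X. F x) \<and> (\<exists>c\<in>C. t [^] n = f \<otimes> c)" by (rule allI)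
    then have "\<exists>\<phi>. \<forall>n :: nat. \<phi> n \<in> (\<Union>x\<in>X. F x) \<and> (\<exists>c\<in>C. t [^] n = \<phi> n \<otimes> c)" by (rule choice)
    then obtain \<phi> where phi: "\<forall>n :: nat. \<phi> n \<in> (\<Union>x\<in>X. F x) \<and> (\<exists>c\<in>C. t [^] n = \<phi> n \<otimes> c)" by (elim exE)
    note \<phi> = phi[rule_format]
    have "finite (range \<phi>)"
      using F X \<phi> by (intro finite_subset[of "range \<phi>" "\<Union>x\<in>X. F x"]) auto
    then have "\<not> inj \<phi>" using finite_imageD infinite_UNIV_nat by blast
    then obtain i j where "\<phi> i = \<phi> j" "i \<noteq> j" by (auto simp: inj_def)
    then obtain m n where mn: "m < n" "\<phi> m = \<phi> n"
      using that[of i j] that[of j i] by (cases "i < j") auto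
    obtain c where c: "c \<in> C" "t [^] m = \<phi> m \<otimes> c" using \<phi>[of m] by (elim conjE bexE)
    obtain c' where c': "c' \<in> C" "t [^] n = \<phi> m \<otimes> c'"
      unfolding mn(2) using \<phi>[of n] by (elim conjE bexE)
    have carr: "\<phi> m \<in> carrier G" "c \<in> carrier G" "c' \<in> carrier G"
      using \<phi>[of m] F c c' C_carrier by auto
    have "t [^] n = t [^] m \<otimes> t [^] (n - m)" using t mn by (simp add: nat_pow_mult)
    then have "t [^] (n - m) = inv (t [^] m) \<otimes> t [^] n" using t by simp
    also have "\<dots> = inv c \<otimes> c'" using c c' carr by (simp add: inv_mult_group m_assoc)
    finally have "t [^] (n - m) \<in> C"
      using c c' subgroup_C by (simp add: subgroup.m_closed subgroup.m_inv_closed)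
    moreover have "E (t [^] (n - m)) \<one>" using pow[of "n - Suc m"] Suc_diff_Suc[OF mn(1)] by simp
    ultimately show False using EC by blast
  qed
qed

text \<open>The conditions on \<open>t\<close> make the translates of the half-space by powers of
  \<open>t\<close> a descending chain that \<open>escape\<close> can push off any finite set;
  \<open>F\<close> supplies the covering.\<close>

lemma half_space_criterion:
  assumes t: "t \<in> carrier G" and Et: "E t \<one>"
    and nest: "\<And>x. \<lbrakk>x \<in> carrier G; E x \<one>\<rbrakk> \<Longrightarrow> E (t \<otimes> x) \<one>"
    and EC: "\<And>c. c \<in> C \<Longrightarrow> \<not> E c \<one>"
    and F: "finite F" "F \<subseteq> carrier G"
    and cover: "\<And>x. x \<in> carrier G \<Longrightarrow> \<exists>f\<in>F. E (f \<otimes> x) \<one> \<or> E (f \<otimes> inv x) \<one>"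
  shows "half_space C {x \<in> carrier G. E x \<one>}"
  unfolding half_space_def
proof (intro conjI allI impI)
  show "coset_boundary C {x \<in> carrier G. E x \<one>}" by (rule coset_boundary_cocycle)
  show "\<exists>F. finite F \<and> F \<subseteq> carrier G \<and> (\<forall>x\<in>carrier G. \<exists>f\<in>F.
      f \<otimes> x \<in> {x \<in> carrier G. E x \<one>} \<or> f \<otimes> inv x \<in> {x \<in> carrier G. E x \<one>})"
  proof (intro exI[of _ F] conjI ballI)
    fix x assume x: "x \<in> carrier G"
    obtain f where "f \<in> F" "E (f \<otimes> x) \<one> \<or> E (f \<otimes> inv x) \<one>"
      using cover[OF x] by (elim bexE)
    then show "\<exists>f\<in>F. f \<otimes> x \<in> {x \<in> carrier G. E x \<one>} \<or> f \<otimes> inv x \<in> {x \<in> carrier G. E x \<one>}"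
      using F x by (intro bexI[of _ f]) auto
  qed (use F in auto)
  show "\<exists>g\<in>carrier G. \<forall>x\<in>X. g \<otimes> x \<notin> {x \<in> carrier G. E x \<one>}"
    if "finite X \<and> X \<subseteq> carrier G" for X
    using escape[OF t Et nest EC that] .
qed auto

text \<open>The base vertex is that of \<open>A\<close>. The path to its image under
  \<open>b\<close> in \<open>B\<close> crosses \<open>C\<close> to the vertex of \<open>B\<close>
  and leaves by \<open>b C\<close>; the two cancel for \<open>b\<close> in \<open>C\<close>, hence
  the formula \<open>EB\<close>. The argument is ping-pong: \<open>b\<close> in \<open>B - C\<close>
  carries the complement of the half-space into it, \<open>a\<close> in \<open>A - C\<close> carries
  the half-space into its complement, so \<open>b \<otimes> a\<close> nests it.\<close>

lemma amalgam_half_space: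
  assumes A: "subgroup A G" and B: "subgroup B G" and CA: "C \<subset> A" and CB: "C \<subset> B"
    and Y: "Y = A \<union> B"
    and EA: "\<And>a g. \<lbrakk>a \<in> A; g \<in> carrier G\<rbrakk> \<Longrightarrow> \<not> E a g"
    and EB: "\<And>b g. \<lbrakk>b \<in> B; g \<in> carrier G\<rbrakk> \<Longrightarrow> E b g = ((g \<in> C) \<noteq> (inv b \<otimes> g \<in> C))"
  shows "half_space C {x \<in> carrier G. E x \<one>}"
proof -
  interpret A: subgroup A G by (rule A)
  interpret B: subgroup B G by (rule B)
  interpret C: subgroup C G by (rule subgroup_C)
  note A_iff = subgroup_mult_left_iff[OF A] subgroup_mult_right_iff[OF A] subgroup_inv_iff[OF A]
  note B_iff = subgroup_mult_left_iff[OF B] subgroup_mult_right_iff[OF B] subgroup_inv_iff[OF B]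
  note C_iff = subgroup_mult_left_iff[OF subgroup_C] subgroup_mult_right_iff[OF subgroup_C]
    subgroup_inv_iff[OF subgroup_C]
  have CA': "g \<in> C \<Longrightarrow> g \<in> A" and CB': "g \<in> C \<Longrightarrow> g \<in> B" for g using CA CB by auto
  have step_A: "E (x \<otimes> a) g = E x g" if "x \<in> carrier G" "a \<in> A" "g \<in> carrier G" for x a g
    using cocycle[of x a g] EA[of a "inv x \<otimes> g"] that by simp
  \<comment> \<open>The base vertex is joined to the vertex of \<open>B\<close> by the edge
    \<open>C\<close>, so a geodesic using any edge at the vertex of \<open>B\<close> has arrived
    through \<open>C\<close>.\<close>
  have B_edges: "E x b \<longrightarrow> E x \<one>" if "x \<in> carrier G" "b \<in> B" for x b
    using that
  proof (induction rule: letter_induct)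
    case one
    then show ?case using E_one by simp
  next
    case (step x s)
    note b = \<open>b \<in> B\<close> and x = \<open>x \<in> carrier G\<close>
    consider "s \<in> A" | "s \<in> B" "x \<in> B" | "s \<in> B" "x \<notin> B" using step Y by auto
    then show ?case
    proof cases
      case 1
      then show ?thesis using step step_A by simp
    next
      case 2
      then have xs: "x \<otimes> s \<in> B" by simp
      then show ?thesis using EB[OF xs, of b] EB[OF xs, of \<one>] b
        by (cases "inv (x \<otimes> s) \<in> C") (simp_all add: C_iff)
    next
      case 3
      \<comment> \<open>The edges changed by \<open>s\<close> lie in \<open>x B\<close>, which is
        disjoint from \<open>B\<close>.\<close>
      have "E (x \<otimes> s) g = E x g" if "g \<in> B" for g
      proof -
        have "inv x \<otimes> g \<notin> B" using that 3 x by (simp add: B_iff)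
        moreover from this have "inv s \<otimes> (inv x \<otimes> g) \<notin> B" using that 3 x by (simp add: B_iff)
        ultimately have "\<not> E s (inv x \<otimes> g)" using EB[of s "inv x \<otimes> g"] 3 x that CB' by auto
        then show ?thesis using cocycle[of x s g] that 3 x by simp
      qed
      then show ?thesis using step.IH b by simp
    qed
  qed
  \<comment> \<open>A geodesic leaves the base vertex by at most one edge.\<close>
  have A_edges: "\<not> (E x \<one> \<and> E x a)" if "x \<in> carrier G" "a \<in> A - C" for x a
    using that
  proof (induction rule: letter_induct)
    case one
    then show ?case using E_one by simp
  next
    case (step x s)
    note a = \<open>a \<in> A - C\<close> and x = \<open>x \<in> carrier G\<close>
    have s: "s \<in> carrier G" using step letters by auto
    consider "s \<in> A" | "x \<otimes> s \<in> A" | "s \<in> B" "x \<otimes> s \<notin> A" using step Y by auto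
    then show ?case
    proof cases
      case 1
      then show ?thesis using step step_A by simp
    next
      case 2
      then show ?thesis using EA by simp
    next
      case 3
      \<comment> \<open>Of the two edges \<open>x C\<close> and \<open>x s C\<close> toggled by
        \<open>s\<close>, the second is not at the base vertex.\<close>
      have eq: "E (x \<otimes> s) g = (E x g \<noteq> (inv x \<otimes> g \<in> C))" if "g \<in> A" for g
      proof -
        have "inv (x \<otimes> s) \<otimes> g \<notin> A" using that 3 x s A_iff(2)[OF that, of "inv (x \<otimes> s)"]
            A_iff(3)[of "x \<otimes> s"] by simp
        then have "inv s \<otimes> (inv x \<otimes> g) \<notin> C"
          using CA' x s that by (auto simp: inv_mult_group m_assoc)
        then show ?thesis using cocycle[of x s g] EB[of s "inv x \<otimes> g"] 3 x s that by simp
      qed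
      show ?thesis
      proof (cases "x \<in> A")
        case True
        then show ?thesis
          using eq[of a] eq[of \<one>] EA[OF True, of a] EA[OF True, of \<one>] a
            C_iff(1)[of "inv x" a] by auto
      next
        case False
        then have "inv x \<otimes> g \<notin> C" if "g \<in> A" for g
          using CA'[of "inv x \<otimes> g"] that x by (auto simp: A_iff)
        then show ?thesis using eq[of a] eq[of \<one>] step.IH a by auto
      qed
    qed
  qed
  obtain a b where a: "a \<in> A" "a \<notin> C" and b: "b \<in> B" "b \<notin> C" using CA CB by auto
  have ib: "inv b \<notin> C" using b by (simp add: C_iff)
  have ia: "inv a \<in> A - C" using a by (simp add: C_iff)
  have flip_b: "E (b \<otimes> y) \<one>" if "y \<in> carrier G" "\<not> E y \<one>" for y
    using B_edges[of y "inv b"] that b ib EB[of b \<one>] cocycle[of b y \<one>] by auto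
  have flip_a: "\<not> E (a \<otimes> x) \<one>" if "x \<in> carrier G" "E x \<one>" for x
    using A_edges[OF that(1) ia] that a EA[of a \<one>] cocycle[of a x \<one>] by auto
  show ?thesis
  proof (rule half_space_criterion[of "b \<otimes> a" "{\<one>, b}"])
    show "E (b \<otimes> a) \<one>" using flip_b[of a] EA[of a \<one>] a by auto
    show "E (b \<otimes> a \<otimes> x) \<one>" if "x \<in> carrier G" "E x \<one>" for x
      using flip_b[OF _ flip_a[OF that]] that a b by (simp add: m_assoc)
    show "\<exists>f\<in>{\<one>, b}. E (f \<otimes> x) \<one> \<or> E (f \<otimes> inv x) \<one>" if "x \<in> carrier G" for x
      using flip_b[of x] that by (cases "E x \<one>") auto
  qed (use a b EA CA in auto)
qed

lemma cover_at_one: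
  assumes "x \<in> carrier G" "t \<in> carrier G" "E t \<one>"
  shows "E (t \<otimes> x) \<one> \<longleftrightarrow> \<not> E x (inv t)"
  using cocycle[of t x \<one>] assms by simp

end

section \<open>Half-spaces for HNN-extensions\<close>

locale hnn_cocycle = edge_cocycle +
  fixes A :: "'a set" and t :: 'a
  assumes subgroup_A: "subgroup A G" and C_sub: "C \<subseteq> A" and t: "t \<in> carrier G"
    and conj: "c \<in> C \<Longrightarrow> t \<otimes> c \<otimes> inv t \<in> A"
    and Y: "Y = A \<union> {t, inv t}"
    and EA: "\<lbrakk>a \<in> A; g \<in> carrier G\<rbrakk> \<Longrightarrow> \<not> E a g"
    and Et: "g \<in> carrier G \<Longrightarrow> E t g = (inv t \<otimes> g \<in> C)"
begin

text \<open>The edge \<open>C\<close> joins the base vertex to its image under \<open>inv t\<close>;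
  its translate \<open>t C\<close> joins the base vertex to its image under
  \<open>t\<close>.\<close>

lemma E_inv_t: "g \<in> carrier G \<Longrightarrow> E (inv t) g = (g \<in> C)"
  using E_inv[OF t, of g] Et[of "t \<otimes> g"] t by simp

lemma A_carrier: "a \<in> A \<Longrightarrow> a \<in> carrier G"
  using subgroup.mem_carrier[OF subgroup_A] .

lemma E_mult_A: "\<lbrakk>x \<in> carrier G; a \<in> A; g \<in> carrier G\<rbrakk> \<Longrightarrow> E (x \<otimes> a) g = E x g"
  using cocycle[of x a g] EA[of a "inv x \<otimes> g"] A_carrier by simp

lemma E_A_mult: "\<lbrakk>x \<in> carrier G; a \<in> A; g \<in> carrier G\<rbrakk> \<Longrightarrow> E (a \<otimes> x) g = E x (inv a \<otimes> g)"
  using cocycle[of a x g] EA[of a g] A_carrier by simp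

lemma E_inv_t_one: "E (inv t) \<one>"
  using E_inv_t[of \<one>] subgroup.one_closed[OF subgroup_C] by simp

lemma A_iff:
  "\<lbrakk>a \<in> A; y \<in> carrier G\<rbrakk> \<Longrightarrow> a \<otimes> y \<in> A \<longleftrightarrow> y \<in> A"
  "\<lbrakk>a \<in> A; y \<in> carrier G\<rbrakk> \<Longrightarrow> y \<otimes> a \<in> A \<longleftrightarrow> y \<in> A"
  "y \<in> carrier G \<Longrightarrow> inv y \<in> A \<longleftrightarrow> y \<in> A"
  using subgroup_mult_left_iff[OF subgroup_A] subgroup_mult_right_iff[OF subgroup_A]
    subgroup_inv_iff[OF subgroup_A] by simp_all

text \<open>
  The edges at the base vertex are \<open>gC\<close> with \<open>g \<in> A\<close> or \<open>g \<in> At\<close>.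
\<close>

lemma unique_base_edge:
  assumes "x \<in> carrier G"
  shows "\<forall>g\<in>carrier G. \<forall>g'\<in>carrier G. (g \<in> A \<or> g \<otimes> inv t \<in> A) \<longrightarrow> (g' \<in> A \<or> g' \<otimes> inv t \<in> A)
    \<longrightarrow> E x g \<longrightarrow> E x g' \<longrightarrow> inv g \<otimes> g' \<in> C"
  using assms
proof (induction rule: letter_induct)
  case one
  then show ?case using E_one by simp
next
  case (step x s)
  note x = \<open>x \<in> carrier G\<close>
  have same: "inv g \<otimes> g' \<in> C" if "inv k \<otimes> g \<in> C" "inv k \<otimes> g' \<in> C"
    "k \<in> carrier G" "g \<in> carrier G" "g' \<in> carrier G" for k g g'
  proof -
    have "inv (inv k \<otimes> g) \<otimes> (inv k \<otimes> g') \<in> C"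
      using that subgroup_C by (blast intro: subgroup.m_closed subgroup.m_inv_closed)
    then show ?thesis using that by (simp add: inv_mult_group m_assoc)
  qed
  consider (A) "s \<in> A" | (st) "s = t" | (it) "s = inv t" using step Y by auto
  then show ?case
  proof cases
    case A
    then show ?thesis using step.IH E_mult_A[OF x] by simp
  next
    case st
    have new: "E (x \<otimes> t) g = (E x g \<noteq> (inv (x \<otimes> t) \<otimes> g \<in> C))" if "g \<in> carrier G" for g
      using cocycle[of x t g] Et[of "inv x \<otimes> g"] x t that
      by (simp add: inv_mult_group m_assoc)
    \<comment> \<open>Appending \<open>t\<close> toggles the single edge \<open>x t C\<close>, whose
      ends are the images of the base vertex under \<open>x\<close> and \<open>x t\<close>. If the
      first end is the base vertex, there was no edge before; if the second is, there is none
      afterwards; otherwise the toggled edge is not at the base vertex.\<close>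
    consider "x \<in> A" | "x \<otimes> t \<in> A" | "x \<notin> A" "x \<otimes> t \<notin> A" by auto
    then show ?thesis
    proof cases
      case 1
      then show ?thesis using new EA[OF 1] same[of "x \<otimes> t"] x t st by auto
    next
      case 2
      then show ?thesis using EA[OF 2] st by simp
    next
      case 3
      have "inv (x \<otimes> t) \<otimes> g \<notin> C" if g: "g \<in> carrier G" "g \<in> A \<or> g \<otimes> inv t \<in> A" for g
      proof
        assume c: "inv (x \<otimes> t) \<otimes> g \<in> C"
        define c' where "c' = inv (x \<otimes> t) \<otimes> g"
        have c': "c' \<in> C" "c' \<in> carrier G" "c' \<in> A" using c C_carrier C_sub by (auto simp: c'_def)
        have g1: "g = (x \<otimes> t) \<otimes> c'" using g x t by (simp add: c'_def)
        then have "g \<otimes> inv t = x \<otimes> (t \<otimes> c' \<otimes> inv t)"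
          using c' x t by (simp add: m_assoc)
        then have "g \<otimes> inv t \<notin> A" using 3 A_iff(2)[OF conj[OF c'(1)] x] by simp
        moreover have "g \<notin> A" using g1 3 A_iff(2)[OF c'(3), of "x \<otimes> t"] x t by simp
        ultimately show False using g by simp
      qed
      then show ?thesis using new step.IH st by simp
    qed
  next
    case it
    have new: "E (x \<otimes> inv t) g = (E x g \<noteq> (inv x \<otimes> g \<in> C))" if "g \<in> carrier G" for g
      using cocycle[of x "inv t" g] E_inv_t[of "inv x \<otimes> g"] x t that by simp
    consider "x \<in> A" | "x \<otimes> inv t \<in> A" | "x \<notin> A" "x \<otimes> inv t \<notin> A" by auto
    then show ?thesis
    proof cases
      case 1
      then show ?thesis using new EA[OF 1] same[of x] x it by auto
    next
      case 2
      then show ?thesis using EA[OF 2] it by simp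
    next
      case 3
      have "inv x \<otimes> g \<notin> C" if g: "g \<in> carrier G" "g \<in> A \<or> g \<otimes> inv t \<in> A" for g
      proof
        assume c: "inv x \<otimes> g \<in> C"
        define c' where "c' = inv x \<otimes> g"
        have c': "c' \<in> C" "c' \<in> carrier G" "c' \<in> A" using c C_carrier C_sub by (auto simp: c'_def)
        have g1: "g = x \<otimes> c'" using g x by (simp add: c'_def)
        then have "g \<otimes> inv t = (x \<otimes> inv t) \<otimes> (t \<otimes> c' \<otimes> inv t)"
          using c' x t by (simp add: m_assoc)
        then have "g \<otimes> inv t \<notin> A"
          using 3 A_iff(2)[OF conj[OF c'(1)], of "x \<otimes> inv t"] x t by simp
        moreover have "g \<notin> A" using g1 3 A_iff(2)[OF c'(3) x] by simp
        ultimately show False using g by simp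
      qed
      then show ?thesis using new step.IH it by simp
    qed
  qed
qed

lemma t_notin_A: "t \<notin> A"
  using EA[of t t] Et[of t] t subgroup.one_closed[OF subgroup_C] by auto

text \<open>\<open>C\<close> and \<open>t C\<close> are different edges at the base vertex, and a
  geodesic from there uses only one of them.\<close>

lemma not_both_edges:
  assumes "x \<in> carrier G" "E x \<one>"
  shows "\<not> E x t"
proof
  assume "E x t"
  then have "t \<in> C"
    using bspec[OF bspec[OF unique_base_edge[OF assms(1)], of \<one>], of t] assms t
      subgroup.one_closed[OF subgroup_A] by simp
  then show False using C_sub t_notin_A by auto
qed

text \<open>Since \<open>inv t\<close> crosses \<open>C\<close>, the element
  \<open>inv t \<otimes> x\<close> fails to cross \<open>C\<close> only if \<open>x\<close> crosses
  \<open>t C\<close>.\<close>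

lemma inv_t_nest:
  assumes "x \<in> carrier G" "E x \<one>"
  shows "E (inv t \<otimes> x) \<one>"
  using cover_at_one[OF assms(1), of "inv t"] E_inv_t_one not_both_edges[OF assms] t by simp

lemma not_E_C: "c \<in> C \<Longrightarrow> \<not> E c \<one>"
  using EA C_sub by auto

text \<open>The hypothesis says that conjugation by \<open>t\<close> does not map \<open>C\<close>
  onto \<open>A\<close>. Then \<open>t C\<close> and \<open>inv a t C\<close> are different edges at
  the base vertex, and \<open>x\<close> crosses at most one. Missing the first puts
  \<open>inv t x\<close> into the half-space, missing the second puts \<open>inv t a x\<close>
  there; this is the origin of the covering set.\<close>

lemma ascending_half_space:
  assumes a: "a \<in> A" "inv t \<otimes> a \<otimes> t \<notin> C"
  shows "half_space C {x \<in> carrier G. E x \<one>}"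
proof (rule half_space_criterion[of "inv t" "{\<one>, inv t, inv t \<otimes> a}"])
  show "\<exists>f\<in>{\<one>, inv t, inv t \<otimes> a}. E (f \<otimes> x) \<one> \<or> E (f \<otimes> inv x) \<one>" if x: "x \<in> carrier G" for x
  proof (cases "E x t")
    case False
    then show ?thesis using cover_at_one[OF x, of "inv t"] E_inv_t_one t by simp
  next
    case True
    have ac: "a \<in> carrier G" using a A_carrier by simp
    have "\<not> E x (inv a \<otimes> t)"
    proof
      assume "E x (inv a \<otimes> t)"
      moreover have "inv a \<otimes> t \<otimes> inv t \<in> A" using a ac t by (simp add: m_assoc A_iff)
      ultimately have "inv (inv a \<otimes> t) \<otimes> t \<in> C"
        using bspec[OF bspec[OF unique_base_edge[OF x], of "inv a \<otimes> t"], of t] True ac t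
          subgroup.one_closed[OF subgroup_A] by simp
      then show False using a ac t by (simp add: inv_mult_group m_assoc)
    qed
    then have "\<not> E (a \<otimes> x) t" using E_A_mult[OF x a(1), of t] t by simp
    then have "E (inv t \<otimes> (a \<otimes> x)) \<one>"
      using cover_at_one[of "a \<otimes> x" "inv t"] E_inv_t_one t ac x by simp
    then show ?thesis using t ac x by (simp add: m_assoc)
  qed
qed (use t a A_carrier E_inv_t_one inv_t_nest not_E_C in auto)

text \<open>Edges are cosets of \<open>C\<close>, and constancy on cosets passes from the letters to
  all of \<open>G\<close> by the cocycle identity.\<close>

lemma E_right_C:
  assumes "x \<in> carrier G"
  shows "\<forall>g\<in>carrier G. \<forall>c\<in>C. E x (g \<otimes> c) = E x g"
  using assms
proof (induction rule: letter_induct)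
  case one
  then show ?case using E_one C_carrier by simp
next
  case (step x s)
  have "E s (g \<otimes> c) = E s g" if "g \<in> carrier G" "c \<in> C" for g c
  proof -
    have c: "c \<in> carrier G" using that C_carrier by simp
    consider (A) "s \<in> A" | (st) "s = t" | (it) "s = inv t" using step Y by auto
    then show ?thesis
    proof cases
      case A
      then show ?thesis using EA that c by simp
    next
      case st
      then show ?thesis
        using st that c t subgroup_mult_right_iff[OF subgroup_C that(2), of "inv t \<otimes> g"]
        by (simp add: Et m_assoc)
    next
      case it
      then show ?thesis
        using it that c t subgroup_mult_right_iff[OF subgroup_C that(2), of g]
        by (simp add: E_inv_t)
    qed
  qed
  moreover have "s \<in> carrier G" using step letters by auto
  ultimately show ?case using step cocycle[of x s] C_carrier by (simp flip: m_assoc)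
qed

text \<open>
  Here \<open>G\<close> is a semidirect product of \<open>A\<close> with the integers, and inversion exchanges its two ends.
\<close>

lemma normal_half_space:
  assumes CA: "C = A" and norm: "\<And>a. a \<in> A \<Longrightarrow> inv t \<otimes> a \<otimes> t \<in> A"
  shows "half_space C {x \<in> carrier G. E x \<one>}"
proof -
  have power: "\<exists>k :: int. \<exists>a\<in>A. x = t [^] k \<otimes> a" if "x \<in> carrier G" for x
    using that
  proof (induction rule: letter_induct)
    case one
    show ?case using subgroup.one_closed[OF subgroup_A] by (intro exI[of _ 0] bexI[of _ \<one>]) simp_all
  next
    case (step x s)
    obtain k :: int and a where x: "a \<in> A" "x = t [^] k \<otimes> a" using step.IH by (elim exE bexE)
    have a: "a \<in> carrier G" using x A_carrier by simp
    consider (A) "s \<in> A" | (st) "s = t" | (it) "s = inv t" using step Y by auto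
    then show ?case
    proof cases
      case A
      then have "x \<otimes> s = t [^] k \<otimes> (a \<otimes> s)" "a \<otimes> s \<in> A"
        using x a t A_carrier subgroup.m_closed[OF subgroup_A] by (simp_all add: m_assoc)
      then show ?thesis by (intro exI[of _ k] bexI[of _ "a \<otimes> s"])
    next
      case st
      have "t [^] (k + 1) = t [^] k \<otimes> t"
        using int_pow_mult[OF t, of k 1] t by simp
      then have "x \<otimes> s = t [^] (k + 1) \<otimes> (inv t \<otimes> a \<otimes> t)"
        using x a st t by (simp add: m_assoc)
      then show ?thesis using norm[OF x(1)] by (intro exI[of _ "k + 1"] bexI[of _ "inv t \<otimes> a \<otimes> t"])
    next
      case it
      have "t [^] (k - 1) = t [^] k \<otimes> inv t"
        using int_pow_mult[OF t, of k "-1"] t by (simp add: int_pow_neg)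
      then have "x \<otimes> s = t [^] (k - 1) \<otimes> (t \<otimes> a \<otimes> inv t)"
        using x a it t by (simp add: m_assoc)
      then show ?thesis using conj[of a] x CA by (intro exI[of _ "k - 1"] bexI[of _ "t \<otimes> a \<otimes> inv t"]) auto
    qed
  qed
  have neg: "E (inv t [^] Suc n) \<one>" for n :: nat
  proof (induction n)
    case (Suc n)
    then have "E (inv t \<otimes> inv t [^] Suc n) \<one>" using inv_t_nest t by simp
    then show ?case using nat_pow_Suc2[of "inv t" "Suc n"] t by simp
  qed (use t E_inv_t_one in simp)
  have neg_int: "E (t [^] k) \<one>" if "k < 0" for k :: int
  proof -
    have "t [^] k = inv (t [^] nat (- k))" using that int_pow_def2[of G t k] by simp
    also have "\<dots> = inv t [^] Suc (nat (- k) - 1)" using that nat_pow_inv[OF t] by simp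
    finally show ?thesis using neg by simp
  qed
  show ?thesis
  proof (rule half_space_criterion[of "inv t" "{\<one>, inv t}"])
    fix x assume x: "x \<in> carrier G"
    obtain k :: int and a where ka: "a \<in> A" "x = t [^] k \<otimes> a" using power[OF x] by (elim exE bexE)
    have a: "a \<in> carrier G" using ka A_carrier by simp
    consider "k = 0" | "k < 0" | "k > 0" by linarith
    then show "\<exists>f\<in>{\<one>, inv t}. E (f \<otimes> x) \<one> \<or> E (f \<otimes> inv x) \<one>"
    proof cases
      case 1
      then have "x \<in> A" using ka a by simp
      then show ?thesis using E_mult_A[of "inv t" x \<one>] E_inv_t_one t by simp
    next
      case 2
      then have "E x \<one>" using E_mult_A[of "t [^] k" a \<one>] neg_int ka t by simp
      then show ?thesis using x by simp
    next
      case 3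
      \<comment> \<open>For positive \<open>k\<close> the inverse is tested. Its left factor
        \<open>inv a\<close> replaces the edge \<open>C\<close> by \<open>a C\<close>, which is the
        same edge because \<open>a\<close> lies in \<open>A = C\<close>.\<close>
      have "inv x = inv a \<otimes> t [^] (- k)" using ka a t by (simp add: inv_mult_group int_pow_neg)
      moreover have "E (t [^] (- k)) (\<one> \<otimes> a)"
        using E_right_C[of "t [^] (- k)"] neg_int[of "- k"] 3 ka CA t by auto
      ultimately have "E (inv x) \<one>"
        using E_A_mult[of "t [^] (- k)" "inv a" \<one>] subgroup.m_inv_closed[OF subgroup_A ka(1)] a t by simp
      then show ?thesis using x by simp
    qed
  qed (use t E_inv_t_one inv_t_nest not_E_C in auto)
qed

text \<open>The same tree, with \<open>t\<close> replaced by its inverse. As \<open>A\<close> is the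
  conjugate of \<open>C\<close> by \<open>t\<close>, the coset \<open>g A\<close> names the edge
  \<open>g t C\<close>, which explains the shift by \<open>t\<close> in the new cocycle.\<close>

lemma reversed:
  assumes A: "A = (\<lambda>c. t \<otimes> c \<otimes> inv t) ` C"
  shows "hnn_cocycle G A (\<lambda>x g. E x (g \<otimes> t)) Y A (inv t)"
proof (intro hnn_cocycle.intro edge_cocycle.intro edge_cocycle_axioms.intro hnn_cocycle_axioms.intro)
  show "group G" by (rule is_group)
  show "subgroup A G" "subgroup A G" by (rule subgroup_A)+
  show "E (x \<otimes> y) (g \<otimes> t) = (E x (g \<otimes> t) \<noteq> E y (inv x \<otimes> g \<otimes> t))"
    if "x \<in> carrier G" "y \<in> carrier G" "g \<in> carrier G" for x y g
    using cocycle[of x y "g \<otimes> t"] that t by (simp add: m_assoc)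
  show "Y \<subseteq> carrier G" by (rule letters)
  show "Q x" if "x \<in> carrier G" "Q \<one>" "\<And>x s. \<lbrakk>x \<in> carrier G; s \<in> Y; Q x\<rbrakk> \<Longrightarrow> Q (x \<otimes> s)" for Q x
    using that by (rule letter_induct)
  show "\<exists>F. finite F \<and> F \<subseteq> carrier G \<and> (\<forall>g\<in>carrier G. E s (g \<otimes> t) \<longrightarrow> (\<exists>f\<in>F. \<exists>c\<in>A. g = f \<otimes> c))"
    if "s \<in> Y" for s
  proof -
    obtain F where F: "finite F" "F \<subseteq> carrier G" "\<forall>g\<in>carrier G. E s g \<longrightarrow> (\<exists>f\<in>F. \<exists>c\<in>C. g = f \<otimes> c)"
      using letter_finite[OF \<open>s \<in> Y\<close>] by (elim exE conjE)
    show ?thesis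
    proof (intro exI[of _ "(\<lambda>f. f \<otimes> inv t) ` F"] conjI ballI impI)
      fix g assume g: "g \<in> carrier G" "E s (g \<otimes> t)"
      then have "\<exists>f\<in>F. \<exists>c\<in>C. g \<otimes> t = f \<otimes> c" using F(3) t by simp
      then obtain f c where fc: "f \<in> F" "c \<in> C" "g \<otimes> t = f \<otimes> c" by (elim bexE)
      have carr: "f \<in> carrier G" "c \<in> carrier G" using fc F(2) C_carrier by auto
      have "g = (g \<otimes> t) \<otimes> inv t" using g t by (simp add: m_assoc)
      also have "\<dots> = (f \<otimes> inv t) \<otimes> (t \<otimes> c \<otimes> inv t)"
        unfolding fc(3) using carr t by (simp add: m_assoc)
      finally have "g = (f \<otimes> inv t) \<otimes> (t \<otimes> c \<otimes> inv t)" .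
      moreover have "t \<otimes> c \<otimes> inv t \<in> A" by (rule conj[OF fc(2)])
      ultimately show "\<exists>f\<in>(\<lambda>f. f \<otimes> inv t) ` F. \<exists>c\<in>A. g = f \<otimes> c"
        using fc(1) by (intro bexI[of _ "f \<otimes> inv t"] bexI[of _ "t \<otimes> c \<otimes> inv t"]) auto
    qed (use F t in auto)
  qed
  show "A \<subseteq> A" by simp
  show "inv t \<in> carrier G" using t by simp
  show "inv t \<otimes> c \<otimes> inv (inv t) \<in> A" if "c \<in> A" for c
  proof -
    obtain c' where "c' \<in> C" "c = t \<otimes> c' \<otimes> inv t"
      using \<open>c \<in> A\<close> unfolding A by (elim imageE)
    then show ?thesis using C_sub C_carrier t by (auto simp: m_assoc)
  qed
  show "Y = A \<union> {inv t, inv (inv t)}" using Y t by auto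
  show "\<not> E a (g \<otimes> t)" if "a \<in> A" "g \<in> carrier G" for a g
    using EA[of a "g \<otimes> t"] that t by simp
  show "E (inv t) (g \<otimes> t) = (inv (inv t) \<otimes> g \<in> A)" if "g \<in> carrier G" for g
  proof -
    have "t \<otimes> g \<in> A \<longleftrightarrow> g \<otimes> t \<in> C"
    proof
      assume "t \<otimes> g \<in> A"
      then obtain c where c: "c \<in> C" "t \<otimes> g = t \<otimes> c \<otimes> inv t" unfolding A by (elim imageE)
      have "g = inv t \<otimes> (t \<otimes> g)" using that t by simp
      also have "\<dots> = c \<otimes> inv t" unfolding c(2) using c(1) C_carrier t by (simp add: m_assoc)
      finally show "g \<otimes> t \<in> C" using c(1) C_carrier t by (simp add: m_assoc)
    next
      assume "g \<otimes> t \<in> C"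
      then show "t \<otimes> g \<in> A" using conj[of "g \<otimes> t"] that t by (simp add: m_assoc)
    qed
    then show ?thesis using E_inv_t[of "g \<otimes> t"] that t by simp
  qed
qed

text \<open>If conjugation by \<open>t\<close> does not map \<open>C\<close> onto \<open>A\<close>,
  the tree branches along the edges \<open>a t C\<close> with \<open>a\<close> in \<open>A\<close>.
  If it does but \<open>C\<close> is proper in \<open>A\<close>, the branching is along the edges
  \<open>a C\<close>, so the reversed cocycle applies and its boundary is conjugated back to
  \<open>C\<close>. What remains is \<open>C = A\<close> normalised by \<open>t\<close>, where the
  tree is a line.\<close>

lemma hnn_half_space: "\<exists>H. half_space C H"
proof (cases "\<exists>a\<in>A. inv t \<otimes> a \<otimes> t \<notin> C")
  case True
  then show ?thesis using ascending_half_space by blast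
next
  case False
  then have conj': "inv t \<otimes> a \<otimes> t \<in> C" if "a \<in> A" for a using that by simp
  show ?thesis
  proof (cases "C = A")
    case True
    then show ?thesis using normal_half_space conj' by blast
  next
    case False
    then obtain a where a: "a \<in> A" "a \<notin> C" using C_sub by auto
    have A: "A = (\<lambda>c. t \<otimes> c \<otimes> inv t) ` C"
    proof
      show "A \<subseteq> (\<lambda>c. t \<otimes> c \<otimes> inv t) ` C"
      proof
        fix x assume "x \<in> A"
        moreover from this have "x = t \<otimes> (inv t \<otimes> x \<otimes> t) \<otimes> inv t"
          using A_carrier t by (simp add: m_assoc)
        ultimately show "x \<in> (\<lambda>c. t \<otimes> c \<otimes> inv t) ` C" using conj' by blast
      qed
    qed (use conj in auto)
    have "t \<otimes> a \<otimes> inv t \<notin> A"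
    proof
      assume "t \<otimes> a \<otimes> inv t \<in> A"
      from conj'[OF this] show False using a A_carrier t by (simp add: m_assoc)
    qed
    then have "half_space A {x \<in> carrier G. E x (\<one> \<otimes> t)}"
      using hnn_cocycle.ascending_half_space[OF reversed[OF A] a(1)] t by simp
    then have "half_space C {x \<in> carrier G. E x (\<one> \<otimes> t)}"
      using coset_boundary_conjugate[OF _ t, of A _ C] conj' A_carrier unfolding half_space_def by simp
    then show ?thesis by blast
  qed
qed

end

section \<open>From the presentations to a half-space\<close>

context group begin

lemma is_amalgam_half_space:
  assumes C: "subgroup C G" and A: "subgroup A G" and B: "subgroup B G"
    and CA: "C \<subset> A" and CB: "C \<subset> B" and amalgam: "is_amalgam G A B C"
  shows "\<exists>H. half_space C H"
proof -
  interpret A: subgroup A G by (rule A)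
  interpret B: subgroup B G by (rule B)
  interpret C: subgroup C G by (rule C)
  note C_iff = subgroup_mult_left_iff[OF C] subgroup_inv_iff[OF C]
  have CA': "g \<in> C \<Longrightarrow> g \<in> A" and CB': "g \<in> C \<Longrightarrow> g \<in> B" for g using CA CB by auto
  define X where "X = amalgam_gens (G\<lparr>carrier := A\<rparr>) (G\<lparr>carrier := B\<rparr>)"
  define R where "R = amalgam_rels (G\<lparr>carrier := A\<rparr>) (G\<lparr>carrier := B\<rparr>) C"
  have X: "X = Inl ` A \<union> Inr ` B" by (simp add: X_def amalgam_gens_def)
  obtain h where h: "h \<in> iso (presented_monoid X R) G"
    and hA: "\<And>a. a \<in> A \<Longrightarrow> h (word_class X R [Inl a]) = a"
    and hB: "\<And>b. b \<in> B \<Longrightarrow> h (word_class X R [Inr b]) = b"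
    using amalgam unfolding is_amalgam_def amalgam_def Let_def X_def[symmetric] R_def[symmetric] by auto
  define val :: "'a + 'a \<Rightarrow> 'a" where "val = case_sum (\<lambda>a. a) (\<lambda>b. b)"
  define p :: "'a + 'a \<Rightarrow> 'a \<Rightarrow> bool"
    where "p = case_sum (\<lambda>a g. False) (\<lambda>b g. (g \<in> C) \<noteq> (inv b \<otimes> g \<in> C))"
  have val: "\<forall>l\<in>X. val l = h (word_class X R [l])"
    using hA hB by (auto simp: X val_def)
  \<comment> \<open>In the table of \<open>B\<close> the middle edge \<open>x C\<close> occurs twice
    and cancels; on the two copies of an element of \<open>C\<close> both derivations
    vanish.\<close>
  have rels: "word_deriv val p u g = word_deriv val p v g"
    if "(u, v) \<in> R" "u \<in> lists X" "v \<in> lists X" "g \<in> carrier G" for u v g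
    using that(1) that(4) C.mem_carrier
    by (auto simp: R_def amalgam_rels_def val_def p_def inv_mult_group m_assoc C_iff)
  then have "\<forall>(u, v)\<in>R. u \<in> lists X \<longrightarrow> v \<in> lists X
      \<longrightarrow> (\<forall>g\<in>carrier G. word_deriv val p u g = word_deriv val p v g)" by blast
  note pres = presentation_cocycle[OF h val this]
  obtain E where coc: "\<forall>x\<in>carrier G. \<forall>y\<in>carrier G. \<forall>g\<in>carrier G. E (x \<otimes> y) g = (E x g \<noteq> E y (inv x \<otimes> g))"
    and letter: "\<forall>l\<in>X. \<forall>g\<in>carrier G. E (val l) g = p l g"
    using pres(1) by (elim exE conjE)
  have EA: "\<not> E a g" if "a \<in> A" "g \<in> carrier G" for a g
    using letter[rule_format, of "Inl a" g] that by (simp add: X val_def p_def)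
  have EB: "E b g = ((g \<in> C) \<noteq> (inv b \<otimes> g \<in> C))" if "b \<in> B" "g \<in> carrier G" for b g
    using letter[rule_format, of "Inr b" g] that by (simp add: X val_def p_def)
  have "edge_cocycle G C E (A \<union> B)"
  proof (intro edge_cocycle.intro edge_cocycle_axioms.intro)
    show "Q x" if "x \<in> carrier G" "Q \<one>" "\<And>x s. \<lbrakk>x \<in> carrier G; s \<in> A \<union> B; Q x\<rbrakk> \<Longrightarrow> Q (x \<otimes> s)" for Q x
    proof (rule pres(4)[of Q])
      fix x l assume "x \<in> carrier G" "l \<in> X" "Q x"
      then show "Q (x \<otimes> val l)" by (intro that(3)) (auto simp: X val_def)
    qed (use that in simp_all)
    show "\<exists>F. finite F \<and> F \<subseteq> carrier G \<and> (\<forall>g\<in>carrier G. E s g \<longrightarrow> (\<exists>f\<in>F. \<exists>c\<in>C. g = f \<otimes> c))"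
      if s: "s \<in> A \<union> B" for s
    proof (cases "s \<in> A")
      case True
      then show ?thesis using EA by (intro exI[of _ "{}"]) simp
    next
      case False
      then have sB: "s \<in> B" using s by simp
      show ?thesis
      proof (intro exI[of _ "{\<one>, s}"] conjI ballI impI)
        fix g assume g: "g \<in> carrier G" "E s g"
        then consider "g \<in> C" | "inv s \<otimes> g \<in> C" using EB[OF sB] by auto
        then show "\<exists>f\<in>{\<one>, s}. \<exists>c\<in>C. g = f \<otimes> c"
        proof cases
          case 1
          then show ?thesis using g by (intro bexI[of _ \<one>] bexI[of _ g]) simp_all
        next
          case 2
          then show ?thesis using g sB by (intro bexI[of _ s] bexI[of _ "inv s \<otimes> g"]) simp_all
        qed
      qed (use sB in auto)
    qed
  qed (use coc C is_group in auto)
  then have "half_space C {x \<in> carrier G. E x \<one>}"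
    using edge_cocycle.amalgam_half_space[OF _ A B CA CB HOL.refl, of E] EA EB by simp
  then show ?thesis by blast
qed

lemma word_deriv_trivial: "\<not> word_deriv val (\<lambda>_ _. False) w g"
  by (induction w arbitrary: g) auto

lemma is_hnn_half_space:
  assumes C: "subgroup C G" and A: "subgroup A G" and CA: "C \<subseteq> A"
    and \<phi>: "\<And>c. c \<in> C \<Longrightarrow> \<phi> c \<in> A" and hnn: "is_hnn G A C \<phi>"
  shows "\<exists>H. half_space C H"
proof -
  interpret A: subgroup A G by (rule A)
  interpret C: subgroup C G by (rule C)
  note C_iff = subgroup_mult_left_iff[OF C] subgroup_inv_iff[OF C]
  define X where "X = hnn_gens (G\<lparr>carrier := A\<rparr>)"
  define R where "R = hnn_rels (G\<lparr>carrier := A\<rparr>) C \<phi>"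
  have X: "X = Base ` A \<union> {Stable, Stable_inv}" by (simp add: X_def hnn_gens_def)
  obtain h where h: "h \<in> iso (presented_monoid X R) G"
    and hA: "\<And>a. a \<in> A \<Longrightarrow> h (word_class X R [Base a]) = a"
    using hnn unfolding is_hnn_def hnn_def Let_def X_def[symmetric] R_def[symmetric] by auto
  define val where "val l = h (word_class X R [l])" for l
  define t where "t = val Stable"
  have val_Base: "val (Base a) = a" if "a \<in> A" for a using hA[OF that] by (simp add: val_def)
  have val: "\<forall>l\<in>X. val l = h (word_class X R [l])" by (simp add: val_def)
  \<comment> \<open>The zero derivation respects the relations trivially. It is used to learn that
    the letters take values in \<open>G\<close> and that \<open>Stable_inv\<close> is inverse to
    \<open>t\<close>, which checking the actual derivation presupposes.\<close>
  have "\<forall>(u, v)\<in>R. u \<in> lists X \<longrightarrow> v \<in> lists X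
      \<longrightarrow> (\<forall>g\<in>carrier G. word_deriv val (\<lambda>_ _. False) u g = word_deriv val (\<lambda>_ _. False) v g)"
    by (simp add: word_deriv_trivial)
  note pres0 = presentation_cocycle[OF h val this]
  have "val Stable \<in> carrier G" "val Stable_inv \<in> carrier G" using pres0(3) by (auto simp: X)
  then have t: "t \<in> carrier G" by (simp add: t_def)
  have "word_val val [Stable, Stable_inv] = word_val val []"
    by (rule pres0(2)) (simp_all add: R_def hnn_rels_def X)
  then have "t \<otimes> val Stable_inv = \<one>" using \<open>val Stable_inv \<in> carrier G\<close> by (simp add: t_def)
  then have val_inv: "val Stable_inv = inv t"
    using \<open>val Stable_inv \<in> carrier G\<close> t by (metis inv_mult_cancel(1) r_one inv_closed)
  have conj: "t \<otimes> c \<otimes> inv t \<in> A" if c: "c \<in> C" for c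
  proof -
    have "c \<in> A" using c CA by auto
    have "word_val val [Stable, Base c, Stable_inv] = word_val val [Base (\<phi> c)]"
      using \<open>c \<in> A\<close> c \<phi> by (intro pres0(2)) (auto simp: R_def hnn_rels_def X)
    then have "t \<otimes> c \<otimes> inv t = \<phi> c"
      using c \<phi>[OF c] \<open>c \<in> A\<close> t by (simp add: val_Base val_inv m_assoc flip: t_def)
    then show ?thesis using \<phi>[OF c] by simp
  qed
  define p :: "'a hnn_letter \<Rightarrow> 'a \<Rightarrow> bool" where "p l g =
    (case l of Base a \<Rightarrow> False | Stable \<Rightarrow> inv t \<otimes> g \<in> C | Stable_inv \<Rightarrow> g \<in> C)" for l g
  \<comment> \<open>In the relation for \<open>c\<close> in \<open>C\<close>, the edge
    \<open>t C\<close> added by \<open>Stable\<close> is removed by \<open>Stable_inv\<close>,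
    because \<open>c\<close> fixes the edge \<open>C\<close>.\<close>
  have rels: "word_deriv val p u g = word_deriv val p v g"
    if "(u, v) \<in> R" "u \<in> lists X" "v \<in> lists X" "g \<in> carrier G" for u v g
    using that(1) that(4) C.mem_carrier t subsetD[OF CA]
    by (auto simp: R_def hnn_rels_def p_def inv_mult_group m_assoc C_iff val_Base val_inv t_def[symmetric])
  then have "\<forall>(u, v)\<in>R. u \<in> lists X \<longrightarrow> v \<in> lists X
      \<longrightarrow> (\<forall>g\<in>carrier G. word_deriv val p u g = word_deriv val p v g)" by blast
  note pres = presentation_cocycle[OF h val this]
  obtain E where coc: "\<forall>x\<in>carrier G. \<forall>y\<in>carrier G. \<forall>g\<in>carrier G. E (x \<otimes> y) g = (E x g \<noteq> E y (inv x \<otimes> g))"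
    and letter: "\<forall>l\<in>X. \<forall>g\<in>carrier G. E (val l) g = p l g"
    using pres(1) by (elim exE conjE)
  have EA: "\<not> E a g" if "a \<in> A" "g \<in> carrier G" for a g
    using letter[rule_format, of "Base a" g] that by (simp add: X val_Base p_def)
  have Et: "E t g = (inv t \<otimes> g \<in> C)" if "g \<in> carrier G" for g
    using letter[rule_format, of Stable g] that by (simp add: X p_def t_def)
  have Eti: "E (inv t) g = (g \<in> C)" if "g \<in> carrier G" for g
    using letter[rule_format, of Stable_inv g] that by (simp add: X p_def val_inv)
  have "hnn_cocycle G C E (A \<union> {t, inv t}) A t"
  proof (intro hnn_cocycle.intro edge_cocycle.intro edge_cocycle_axioms.intro hnn_cocycle_axioms.intro)
    show "Q x" if "x \<in> carrier G" "Q \<one>"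
      "\<And>x s. \<lbrakk>x \<in> carrier G; s \<in> A \<union> {t, inv t}; Q x\<rbrakk> \<Longrightarrow> Q (x \<otimes> s)" for Q x
    proof (rule pres(4)[of Q])
      fix x l assume "x \<in> carrier G" "l \<in> X" "Q x"
      then show "Q (x \<otimes> val l)" by (intro that(3)) (auto simp: X val_Base val_inv t_def)
    qed (use that in simp_all)
    show "\<exists>F. finite F \<and> F \<subseteq> carrier G \<and> (\<forall>g\<in>carrier G. E s g \<longrightarrow> (\<exists>f\<in>F. \<exists>c\<in>C. g = f \<otimes> c))"
      if s: "s \<in> A \<union> {t, inv t}" for s
    proof -
      consider "s \<in> A" | "s = t" | "s = inv t" using s by auto
      then show ?thesis
      proof cases
        case 1
        then show ?thesis using EA by (intro exI[of _ "{}"]) simp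
      next
        case 2
        have "\<exists>f\<in>{t}. \<exists>c\<in>C. g = f \<otimes> c" if "g \<in> carrier G" "E t g" for g
          using Et[OF that(1)] that t by (intro bexI[of _ t] bexI[of _ "inv t \<otimes> g"]) simp_all
        then show ?thesis using t 2 by (intro exI[of _ "{t}"]) simp
      next
        case 3
        have "\<exists>f\<in>{\<one>}. \<exists>c\<in>C. g = f \<otimes> c" if "g \<in> carrier G" "E (inv t) g" for g
          using Eti[OF that(1)] that by (intro bexI[of _ \<one>] bexI[of _ g]) simp_all
        then show ?thesis using 3 by (intro exI[of _ "{\<one>}"]) simp
      qed
    qed
  qed (use coc C A CA is_group t EA Et conj in auto)
  from hnn_cocycle.hnn_half_space[OF this] show ?thesis .
qed

lemma splits_over_half_space:
  assumes "splits_over G C"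
  shows "\<exists>H. half_space C H"
  using assms unfolding splits_over_def
proof (elim conjE disjE exE)
  fix A \<phi>
  assume "subgroup C G" "subgroup A G" "C \<subseteq> A" "is_hnn G A C \<phi>"
    and \<phi>: "\<phi> \<in> mon (G\<lparr>carrier := C\<rparr>) (G\<lparr>carrier := A\<rparr>)"
  moreover have "\<phi> c \<in> A" if "c \<in> C" for c
    using \<phi> that by (auto simp: mon_def hom_def)
  ultimately show ?thesis using is_hnn_half_space by blast
qed (rule is_amalgam_half_space)

end

section \<open>Word metric and growth\<close>

text \<open>Elements of word length at most \<open>n\<close>. Letters are multiplied on the right,
  as along arcs of the Cayley graph, so left translations are isometries.\<close>

primrec word_ball :: "('a, 'm) monoid_scheme \<Rightarrow> 'a set \<Rightarrow> nat \<Rightarrow> 'a set" where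
  "word_ball G S 0 = {\<one>\<^bsub>G\<^esub>}"
| "word_ball G S (Suc n) = word_ball G S n
    \<union> (\<Union>x\<in>word_ball G S n. \<Union>s\<in>S. {x \<otimes>\<^bsub>G\<^esub> s, x \<otimes>\<^bsub>G\<^esub> inv\<^bsub>G\<^esub> s})"

lemma word_ball_mono: "m \<le> n \<Longrightarrow> word_ball G S m \<subseteq> word_ball G S n"
  by (rule lift_Suc_mono_le[of "word_ball G S"]) auto

lemma finite_word_ball: "finite S \<Longrightarrow> finite (word_ball G S n)"
  by (induction n) auto

lemma one_in_word_ball: "\<one>\<^bsub>G\<^esub> \<in> word_ball G S n"
  by (induction n) auto

context group begin

lemma word_ball_carrier: "S \<subseteq> carrier G \<Longrightarrow> word_ball G S n \<subseteq> carrier G"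
  by (induction n) auto

lemma word_ball_mult:
  assumes S: "S \<subseteq> carrier G" and x: "x \<in> word_ball G S m"
  shows "y \<in> word_ball G S n \<Longrightarrow> x \<otimes> y \<in> word_ball G S (m + n)"
proof (induction n arbitrary: y)
  case 0
  then show ?case using x word_ball_carrier[OF S, of m] by auto
next
  case (Suc n)
  have xc: "x \<in> carrier G" using x word_ball_carrier[OF S] by auto
  consider "y \<in> word_ball G S n" | z s where "z \<in> word_ball G S n" "s \<in> S" "y = z \<otimes> s \<or> y = z \<otimes> inv s"
    using Suc.prems by auto
  then show ?case
  proof cases
    case 1
    then show ?thesis using Suc.IH by simp
  next
    case 2
    have "z \<in> carrier G" "s \<in> carrier G" using 2 S word_ball_carrier[OF S] by auto
    then have "x \<otimes> y = (x \<otimes> z) \<otimes> s \<or> x \<otimes> y = (x \<otimes> z) \<otimes> inv s" using 2(3) xc by (auto simp: m_assoc)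
    then show ?thesis using Suc.IH[OF 2(1)] 2(2) by auto
  qed
qed

lemma generator_in_word_ball:
  assumes "S \<subseteq> carrier G" "s \<in> S"
  shows "s \<in> word_ball G S 1" "inv s \<in> word_ball G S 1"
proof -
  have "\<one> \<otimes> s \<in> word_ball G S 1" "\<one> \<otimes> inv s \<in> word_ball G S 1" using assms(2) by auto
  then show "s \<in> word_ball G S 1" "inv s \<in> word_ball G S 1" using assms by (simp_all add: subset_iff)
qed

lemma word_ball_inv:
  assumes S: "S \<subseteq> carrier G"
  shows "x \<in> word_ball G S n \<Longrightarrow> inv x \<in> word_ball G S n"
proof (induction n arbitrary: x)
  case (Suc n)
  consider "x \<in> word_ball G S n" | z s where "z \<in> word_ball G S n" "s \<in> S" "x = z \<otimes> s \<or> x = z \<otimes> inv s"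
    using Suc.prems by auto
  then show ?case
  proof cases
    case 1
    then show ?thesis using Suc.IH by simp
  next
    case 2
    have "z \<in> carrier G" "s \<in> carrier G" using 2 S word_ball_carrier[OF S] by auto
    then have "inv x = inv s \<otimes> inv z \<or> inv x = s \<otimes> inv z" using 2(3) by (auto simp: inv_mult_group)
    moreover have "s \<otimes> inv z \<in> word_ball G S (1 + n)" "inv s \<otimes> inv z \<in> word_ball G S (1 + n)"
      using word_ball_mult[OF S generator_in_word_ball(1)[OF S 2(2)] Suc.IH[OF 2(1)]]
        word_ball_mult[OF S generator_in_word_ball(2)[OF S 2(2)] Suc.IH[OF 2(1)]] by simp_all
    ultimately have "inv x \<in> word_ball G S (1 + n)" by metis
    then show ?thesis by simp
  qed
qed simp

end

lemma vwalk_snoc: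
  assumes "vwalk p \<Gamma>" "b \<in> verts \<Gamma>" "(last p, b) \<in> arcs_ends \<Gamma>"
  shows "vwalk (p @ [b]) \<Gamma>"
  using assms by (auto simp: vwalk_def vwalk_arcs_append)

locale cayley = group G for G :: "('a, 'm) monoid_scheme" (structure) +
  fixes S :: "'a set"
  assumes generating: "finite_generating_set G S"
begin

abbreviation ball :: "nat \<Rightarrow> 'a set" where
  "ball \<equiv> word_ball G S"

abbreviation \<Gamma> :: "('a, 'a \<times> 'a) pre_digraph" where
  "\<Gamma> \<equiv> cayley_graph G S"

lemma S_carrier: "S \<subseteq> carrier G" and finite_S: "finite S" and generate_S: "generate G S = carrier G"
  using generating by (auto simp: finite_generating_set_def)

lemmas ball_mult = word_ball_mult[OF S_carrier]
  and ball_inv = word_ball_inv[OF S_carrier]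
  and finite_ball = finite_word_ball[OF finite_S, of G]

lemma ball_carrier: "x \<in> ball n \<Longrightarrow> x \<in> carrier G"
  using word_ball_carrier[OF S_carrier] by auto

lemma ball_mono: "x \<in> ball m \<Longrightarrow> m \<le> n \<Longrightarrow> x \<in> ball n"
  using word_ball_mono[of m n G S] by auto

lemma ex_ball:
  assumes "x \<in> carrier G"
  shows "\<exists>n. x \<in> ball n"
proof -
  have "x \<in> generate G S" using assms generate_S by simp
  then show ?thesis
  proof induction
    case one
    show ?case using one_in_word_ball by blast
  next
    case (incl h)
    show ?case using generator_in_word_ball(1)[OF S_carrier incl] by blast
  next
    case (inv h)
    show ?case using generator_in_word_ball(2)[OF S_carrier inv] by blast
  next
    case (eng h1 h2)
    then show ?case using ball_mult by blast
  qed
qed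

lemma finite_subset_ball:
  assumes "finite X" "X \<subseteq> carrier G"
  shows "\<exists>n. X \<subseteq> ball n"
  using assms
proof (induction X)
  case (insert x X)
  obtain m where m: "X \<subseteq> ball m" using insert by auto
  obtain n where n: "x \<in> ball n" using ex_ball[of x] insert by auto
  have "insert x X \<subseteq> ball (m + n)"
    using m ball_mono[OF n, of "m + n"] word_ball_mono[of m "m + n" G S] by auto
  then show ?case by blast
qed simp

lemma word_ball_comparison:
  assumes "finite S'" "S' \<subseteq> carrier G"
  shows "\<exists>k. \<forall>n. word_ball G S' n \<subseteq> ball (k * n)"
proof -
  obtain k where k: "S' \<subseteq> ball k" using finite_subset_ball[OF assms] by auto
  have "x \<in> ball (k * n)" if "x \<in> word_ball G S' n" for x n
    using that
  proof (induction n arbitrary: x)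
    case (Suc n)
    consider "x \<in> word_ball G S' n"
      | z s where "z \<in> word_ball G S' n" "s \<in> S'" "x = z \<otimes> s \<or> x = z \<otimes> inv s"
      using Suc.prems by auto
    then show ?case
    proof cases
      case 1
      show ?thesis by (rule ball_mono[OF Suc.IH[OF 1]]) simp
    next
      case 2
      have "s \<in> ball k" "inv s \<in> ball k" using k 2(2) ball_inv by auto
      then have "x \<in> ball (k * n + k)" using ball_mult[OF Suc.IH[OF 2(1)]] 2(3) by auto
      then show ?thesis by (simp add: add.commute)
    qed
  qed simp
  then show ?thesis by blast
qed

lemma verts_cayley: "verts \<Gamma> = carrier G"
  by (simp add: cayley_graph_def)

lemma arcs_ends_cayley:
  "(x, y) \<in> arcs_ends \<Gamma> \<longleftrightarrow> x \<in> carrier G \<and> y \<in> carrier G \<and> x \<noteq> y \<and> (\<exists>s\<in>S. y = x \<otimes> s \<or> x = y \<otimes> s)"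
  by (auto simp: arcs_ends_def arc_to_ends_def cayley_graph_def image_iff)

lemma arcs_ends_step:
  assumes "(x, y) \<in> arcs_ends \<Gamma>"
  shows "\<exists>s\<in>S. y = x \<otimes> s \<or> y = x \<otimes> inv s"
proof -
  obtain s where s: "s \<in> S" "y = x \<otimes> s \<or> x = y \<otimes> s" and c: "x \<in> carrier G" "y \<in> carrier G"
    using assms by (auto simp: arcs_ends_cayley)
  have "s \<in> carrier G" using s S_carrier by auto
  then have "y = x \<otimes> s \<or> y = x \<otimes> inv s" using s(2) c by (auto simp: m_assoc)
  then show ?thesis using s(1) by blast
qed

lemma arcs_ends_ball:
  assumes "(x, y) \<in> arcs_ends \<Gamma>"
  shows "inv x \<otimes> y \<in> ball 1"
proof -
  obtain s where s: "s \<in> S" "y = x \<otimes> s \<or> y = x \<otimes> inv s" using arcs_ends_step[OF assms] by auto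
  have "s \<in> carrier G" "x \<in> carrier G" using s S_carrier assms by (auto simp: arcs_ends_cayley)
  then have "inv x \<otimes> y = s \<or> inv x \<otimes> y = inv s" using s(2) by auto
  then show ?thesis using generator_in_word_ball[OF S_carrier s(1)] by auto
qed

lemma vwalk_ball:
  assumes "vwalk p \<Gamma>"
  shows "hd p \<in> carrier G \<and> last p \<in> carrier G \<and> inv (hd p) \<otimes> last p \<in> ball (length p - 1)"
  using assms
proof induction
  case (Base u)
  then show ?case by (simp add: verts_cayley)
next
  case (Cons u v es)
  then have "(inv u \<otimes> v) \<otimes> (inv v \<otimes> last (v # es)) \<in> ball (1 + (length (v # es) - 1))"
    using arcs_ends_ball[OF Cons(1)] by (intro ball_mult) simp_all
  moreover have "u \<in> carrier G" "v \<in> carrier G" using Cons(1) by (simp_all add: arcs_ends_cayley)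
  ultimately show ?case using Cons(2) by (simp add: m_assoc del: word_ball.simps)
qed

lemma ball_vwalk:
  assumes "x \<in> carrier G" "y \<in> ball n"
  shows "\<exists>p. vwalk p \<Gamma> \<and> hd p = x \<and> last p = x \<otimes> y \<and> vwalk_length p \<le> n"
  using assms(2)
proof (induction n arbitrary: y)
  case 0
  then show ?case using assms(1) by (intro exI[of _ "[x]"]) (auto simp: vwalk_def verts_cayley)
next
  case (Suc n)
  consider "y \<in> ball n" | z s where "z \<in> ball n" "s \<in> S" "y = z \<otimes> s \<or> y = z \<otimes> inv s" "y \<notin> ball n"
    using Suc.prems by auto
  then show ?case
  proof cases
    case 1
    obtain p where "vwalk p \<Gamma>" "hd p = x" "last p = x \<otimes> y" "vwalk_length p \<le> n"
      using Suc.IH[OF 1] by (elim exE conjE)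
    then show ?thesis by (intro exI[of _ p]) simp
  next
    case 2
    obtain p where p: "vwalk p \<Gamma>" "hd p = x" "last p = x \<otimes> z" "vwalk_length p \<le> n"
      using Suc.IH[OF 2(1)] by (elim exE conjE)
    have zs: "z \<in> carrier G" "s \<in> carrier G" "y \<in> carrier G"
      using 2(2) S_carrier ball_carrier[OF 2(1)] ball_carrier[OF Suc.prems] by auto
    have "x \<otimes> y = (x \<otimes> z) \<otimes> s \<or> x \<otimes> z = (x \<otimes> y) \<otimes> s"
      using 2(3) zs assms(1) by (auto simp: m_assoc)
    moreover have "x \<otimes> z \<noteq> x \<otimes> y" using 2 zs assms(1) by auto
    ultimately have "(x \<otimes> z, x \<otimes> y) \<in> arcs_ends \<Gamma>"
      using zs assms(1) 2(2) by (auto simp: arcs_ends_cayley)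
    then have "vwalk (p @ [x \<otimes> y]) \<Gamma>"
      using p zs assms(1) by (intro vwalk_snoc) (simp_all add: verts_cayley)
    moreover have "p \<noteq> []" using p(1) by (simp add: vwalk_def)
    ultimately show ?thesis using p by (intro exI[of _ "p @ [x \<otimes> y]"]) auto
  qed
qed

text \<open>A walk of length \<open>n\<close> from \<open>x\<close> to \<open>y\<close> spells a
  word of length \<open>n\<close> for \<open>inv x \<otimes> y\<close>, and conversely. This turns
  distances into statements about \<open>ball\<close>.\<close>

lemma graph_dist_le_iff:
  assumes "x \<in> carrier G" "y \<in> carrier G"
  shows "graph_dist \<Gamma> x y \<le> n \<longleftrightarrow> inv x \<otimes> y \<in> ball n"
proof
  obtain m where "inv x \<otimes> y \<in> ball m" using ex_ball[of "inv x \<otimes> y"] assms by auto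
  then obtain p where "vwalk p \<Gamma>" "hd p = x" "last p = x \<otimes> (inv x \<otimes> y)" "vwalk_length p \<le> m"
    using ball_vwalk[OF assms(1)] by blast
  then have "\<exists>n p. vwalk p \<Gamma> \<and> hd p = x \<and> last p = y \<and> vwalk_length p = n" using assms by auto
  then have "\<exists>p. vwalk p \<Gamma> \<and> hd p = x \<and> last p = y \<and> vwalk_length p = graph_dist \<Gamma> x y"
    unfolding graph_dist_def by (rule LeastI_ex)
  then obtain p where "vwalk p \<Gamma>" "hd p = x" "last p = y" "vwalk_length p = graph_dist \<Gamma> x y"
    by (elim exE conjE)
  then have d: "inv x \<otimes> y \<in> ball (graph_dist \<Gamma> x y)" using vwalk_ball[of p] by auto
  show "inv x \<otimes> y \<in> ball n" if "graph_dist \<Gamma> x y \<le> n" by (rule ball_mono[OF d that])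
next
  assume "inv x \<otimes> y \<in> ball n"
  then obtain p where p: "vwalk p \<Gamma>" "hd p = x" "last p = x \<otimes> (inv x \<otimes> y)" "vwalk_length p \<le> n"
    using ball_vwalk[OF assms(1)] by blast
  then have "graph_dist \<Gamma> x y \<le> vwalk_length p"
    unfolding graph_dist_def using assms by (intro Least_le exI[of _ p]) simp
  then show "graph_dist \<Gamma> x y \<le> n" using p(4) by simp
qed

lemma dist_from_set_le_iff:
  assumes "finite A" "A \<noteq> {}" "A \<subseteq> carrier G" "y \<in> carrier G"
  shows "dist_from_set \<Gamma> A y \<le> n \<longleftrightarrow> (\<exists>a\<in>A. inv a \<otimes> y \<in> ball n)"
  unfolding dist_from_set_def using assms graph_dist_le_iff[of _ y n]
  by (subst Min_le_iff) (auto simp: subset_iff)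

definition nbhd :: "'a set \<Rightarrow> nat \<Rightarrow> 'a set" where
  "nbhd A n = {y \<in> carrier G. \<exists>a\<in>A. inv a \<otimes> y \<in> ball n}"

lemma growth_fun_eq:
  assumes "finite A" "A \<noteq> {}" "A \<subseteq> carrier G" "Y \<subseteq> carrier G"
  shows "growth_fun \<Gamma> Y A n = card (Y \<inter> nbhd A n)"
proof -
  have "{y \<in> Y. dist_from_set \<Gamma> A y \<le> n} = Y \<inter> nbhd A n"
    using assms dist_from_set_le_iff[OF assms(1-3)] by (auto simp: nbhd_def)
  then show ?thesis by (simp add: growth_fun_def)
qed

lemma nbhd_mono: "m \<le> n \<Longrightarrow> nbhd A m \<subseteq> nbhd A n"
  unfolding nbhd_def using ball_mono by blast

lemma nbhd_one: "nbhd {\<one>} n = ball n"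
  using ball_carrier by (auto simp: nbhd_def)

lemma nbhd_change_base:
  assumes "finite A" "A \<subseteq> carrier G" "A' \<noteq> {}" "A' \<subseteq> carrier G"
  shows "\<exists>c. \<forall>n. nbhd A n \<subseteq> nbhd A' (n + c)"
proof -
  obtain a' where a': "a' \<in> A'" "a' \<in> carrier G" using assms by auto
  obtain c where c: "(\<lambda>a. inv a' \<otimes> a) ` A \<subseteq> ball c"
    using finite_subset_ball[of "(\<lambda>a. inv a' \<otimes> a) ` A"] assms a' by auto
  have "y \<in> nbhd A' (n + c)" if yn: "y \<in> nbhd A n" for y n
  proof -
    obtain a where a: "a \<in> A" "inv a \<otimes> y \<in> ball n" and y: "y \<in> carrier G"
      using yn by (auto simp: nbhd_def)
    have "(inv a' \<otimes> a) \<otimes> (inv a \<otimes> y) \<in> ball (c + n)" using c a by (intro ball_mult) auto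
    moreover have "a \<in> carrier G" using a assms by auto
    ultimately have "inv a' \<otimes> y \<in> ball (n + c)" using a' y by (simp add: m_assoc add.commute)
    then show ?thesis using a' y by (auto simp: nbhd_def)
  qed
  then show ?thesis by blast
qed

lemma finite_nbhd:
  assumes "finite A" "A \<subseteq> carrier G"
  shows "finite (nbhd A n)"
proof -
  obtain c where "\<forall>n. nbhd A n \<subseteq> nbhd {\<one>} (n + c)" using nbhd_change_base[OF assms, of "{\<one>}"] by auto
  then show ?thesis using finite_ball finite_subset unfolding nbhd_one by metis
qed

end

section \<open>The growth preorder, growth of subsets of the Cayley graph and of the
  subgroup\<close>

lemma growth_le_trans:
  assumes "f \<preceq>\<^sub>g g" "g \<preceq>\<^sub>g h" "mono h"
  shows "f \<preceq>\<^sub>g h"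
proof -
  obtain k where k: "\<And>n. f n \<le> k * g (k * n + k) + k" using assms(1) by (auto simp: growth_le_def)
  obtain l where l: "l > 0" "\<And>n. g n \<le> l * h (l * n + l) + l" using assms(2) by (auto simp: growth_le_def)
  \<comment> \<open>A single constant must dominate the factor \<open>k * l\<close>, the additive
    term \<open>k * l + k\<close>, and the coefficients \<open>k * l\<close> and
    \<open>k * l + l\<close> of the composed argument.\<close>
  define M where "M = k * l + k + l"
  have "f n \<le> M * h (M * n + M) + M" for n
  proof -
    have "l * (k * n + k) + l \<le> M * n + M" by (simp add: M_def algebra_simps)
    then have h: "h (l * (k * n + k) + l) \<le> h (M * n + M)" by (rule monoD[OF assms(3)])
    have "f n \<le> k * g (k * n + k) + k" by (rule k)
    also have "\<dots> \<le> k * (l * h (l * (k * n + k) + l) + l) + k" using l(2) by simp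
    also have "\<dots> \<le> k * (l * h (M * n + M) + l) + k" using h by simp
    also have "\<dots> = (k * l) * h (M * n + M) + (k * l + k)" by (simp add: algebra_simps)
    also have "\<dots> \<le> M * h (M * n + M) + M" by (intro add_mono mult_right_mono) (simp_all add: M_def)
    finally show ?thesis .
  qed
  then show ?thesis unfolding growth_le_def using l(1) by (intro exI[of _ M]) (simp add: M_def)
qed

lemma growth_leI:
  assumes "\<And>n. f n \<le> k * g (n + c)" "mono g"
  shows "f \<preceq>\<^sub>g g"
  unfolding growth_le_def
proof (intro exI[of _ "k + c + 1"] conjI allI)
  fix n
  have "g (n + c) \<le> g ((k + c + 1) * n + (k + c + 1))"
    by (rule monoD[OF assms(2)]) (simp add: algebra_simps)
  then have "k * g (n + c) \<le> (k + c + 1) * g ((k + c + 1) * n + (k + c + 1))"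
    by (intro mult_mono) simp_all
  then show "f n \<le> (k + c + 1) * g ((k + c + 1) * n + (k + c + 1)) + (k + c + 1)"
    using assms(1)[of n] by linarith
qed simp

lemma growth_class_cong:
  assumes "f \<sim>\<^sub>g g" "mono f" "mono g"
  shows "growth_class f = growth_class g"
  using assms unfolding growth_class_def growth_equiv_def by (blast intro: growth_le_trans)

context cayley begin

lemma mono_growth_fun:
  assumes "finite A" "A \<noteq> {}" "A \<subseteq> carrier G" "Y \<subseteq> carrier G"
  shows "mono (growth_fun \<Gamma> Y A)"
proof (rule monoI)
  fix m n :: nat assume "m \<le> n"
  then show "growth_fun \<Gamma> Y A m \<le> growth_fun \<Gamma> Y A n"
    unfolding growth_fun_eq[OF assms] using nbhd_mono[of m n A] finite_nbhd[OF assms(1,3)]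
    by (intro card_mono) auto
qed

text \<open>Changing the finite base set only shifts the radius, so comparison with balls about
  \<open>\<one>\<close> is enough: one direction is the inclusion of \<open>U\<close>, the other is
  \<open>le\<close>. All classes in the two unions defining \<open>Growth\<close> then
  coincide.\<close>

lemma Growth_eqI:
  assumes U: "U \<subseteq> carrier G" "U \<noteq> {}"
    and le: "\<And>n. card (ball n) \<le> k * card (U \<inter> ball (n + c))"
  shows "Growth \<Gamma> U = Growth \<Gamma> (verts \<Gamma>)"
proof -
  have "growth_class (growth_fun \<Gamma> U A) = growth_class (growth_fun \<Gamma> (carrier G) A')"
    if A: "finite A" "A \<noteq> {}" "A \<subseteq> U" and A': "finite A'" "A' \<noteq> {}" "A' \<subseteq> carrier G" for A A'
  proof (rule growth_class_cong)
    have AG: "A \<subseteq> carrier G" using A U by auto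
    note f = growth_fun_eq[OF A(1,2) AG U(1)] and g = growth_fun_eq[OF A' subset_refl]
    show mf: "mono (growth_fun \<Gamma> U A)" by (rule mono_growth_fun[OF A(1,2) AG U(1)])
    show mg: "mono (growth_fun \<Gamma> (carrier G) A')" by (rule mono_growth_fun[OF A' subset_refl])
    obtain c1 where c1: "\<And>n. nbhd A n \<subseteq> nbhd A' (n + c1)"
      using nbhd_change_base[OF A(1) AG A'(2,3)] by blast
    have "growth_fun \<Gamma> U A n \<le> 1 * growth_fun \<Gamma> (carrier G) A' (n + c1)" for n
    proof -
      have "card (U \<inter> nbhd A n) \<le> card (carrier G \<inter> nbhd A' (n + c1))"
        using U c1[of n] finite_nbhd[OF A'(1,3)] by (intro card_mono) auto
      then show ?thesis by (simp add: f g)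
    qed
    then have 1: "growth_fun \<Gamma> U A \<preceq>\<^sub>g growth_fun \<Gamma> (carrier G) A'" using mg by (rule growth_leI)
    obtain c2 where c2: "\<And>n. nbhd A' n \<subseteq> ball (n + c2)"
      using nbhd_change_base[OF A'(1,3), of "{\<one>}"] unfolding nbhd_one by auto
    obtain c3 where c3: "\<And>n. ball n \<subseteq> nbhd A (n + c3)"
      using nbhd_change_base[of "{\<one>}" A] A(2) AG unfolding nbhd_one by auto
    have "growth_fun \<Gamma> (carrier G) A' n \<le> k * growth_fun \<Gamma> U A (n + (c2 + c + c3))" for n
    proof -
      have "card (carrier G \<inter> nbhd A' n) \<le> card (ball (n + c2))"
        using c2[of n] finite_ball by (intro card_mono) auto
      also have "\<dots> \<le> k * card (U \<inter> ball (n + c2 + c))" by (rule le)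
      also have "\<dots> \<le> k * card (U \<inter> nbhd A (n + c2 + c + c3))"
        using c3[of "n + c2 + c"] finite_nbhd[OF A(1) AG] by (intro mult_left_mono card_mono) auto
      finally show ?thesis by (simp add: f g add.assoc)
    qed
    then have "growth_fun \<Gamma> (carrier G) A' \<preceq>\<^sub>g growth_fun \<Gamma> U A" using mf by (rule growth_leI)
    with 1 show "growth_fun \<Gamma> U A \<sim>\<^sub>g growth_fun \<Gamma> (carrier G) A'" by (simp add: growth_equiv_def)
  qed
  note eq = this
  obtain u where u: "u \<in> U" using U by auto
  have "Growth \<Gamma> Y = growth_class (growth_fun \<Gamma> U {u})" if "Y = U \<or> Y = carrier G" for Y
  proof -
    have ug: "u \<in> carrier G" using u U by auto
    have "growth_class (growth_fun \<Gamma> Y A) = growth_class (growth_fun \<Gamma> U {u})"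
      if "finite A" "A \<noteq> {}" "A \<subseteq> Y" for A
      using \<open>Y = U \<or> Y = carrier G\<close>
    proof
      assume "Y = U"
      then show ?thesis using eq[of A "{u}"] eq[of "{u}" "{u}"] that u ug by simp
    next
      assume "Y = carrier G"
      then show ?thesis using eq[of "{u}" A] that u ug by simp
    qed
    moreover have "finite {u}" "{u} \<noteq> {}" "{u} \<subseteq> Y" using that u ug by auto
    ultimately show ?thesis unfolding Growth_def by blast
  qed
  then show ?thesis by (simp add: verts_cayley)
qed

text \<open>The additive constants of the growth preorder are absorbed by using
  \<open>n + 1\<close>, which is positive, as the base of the power.\<close>

lemma polynomial_growth_bound:
  assumes "Growth \<Gamma> (carrier G) = growth_class (\<lambda>n. n ^ d)"
  shows "\<exists>M. \<forall>n. card (ball n) \<le> M * (n + 1) ^ d"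
proof -
  have m: "mono (\<lambda>n :: nat. n ^ d)" by (intro monoI power_mono) simp_all
  have "(\<lambda>n :: nat. n ^ d) \<preceq>\<^sub>g (\<lambda>n. n ^ d)" using m by (intro growth_leI[of _ 1 _ 0]) simp_all
  then have "(\<lambda>n. n ^ d) \<in> growth_class (\<lambda>n. n ^ d)" using m by (simp add: growth_class_def growth_equiv_def)
  then have "(\<lambda>n. n ^ d) \<in> Growth \<Gamma> (carrier G)" using assms by simp
  then obtain A where A: "finite A" "A \<noteq> {}" "A \<subseteq> carrier G"
    and "growth_fun \<Gamma> (carrier G) A \<preceq>\<^sub>g (\<lambda>n. n ^ d)"
    by (auto simp: Growth_def growth_class_def growth_equiv_def)
  then obtain k where k: "\<And>n. growth_fun \<Gamma> (carrier G) A n \<le> k * (k * n + k) ^ d + k"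
    by (auto simp: growth_le_def)
  obtain c where c: "\<And>n. ball n \<subseteq> nbhd A (n + c)"
    using nbhd_change_base[of "{\<one>}" A] A unfolding nbhd_one by auto
  have "card (ball n) \<le> ((k * k ^ d + k) * (c + 1) ^ d) * (n + 1) ^ d" for n
  proof -
    have "card (ball n) \<le> card (carrier G \<inter> nbhd A (n + c))"
      using c[of n] ball_carrier finite_nbhd[OF A(1,3)] by (intro card_mono) auto
    also have "\<dots> = growth_fun \<Gamma> (carrier G) A (n + c)" by (simp add: growth_fun_eq[OF A subset_refl])
    also have "\<dots> \<le> k * (k * (n + c) + k) ^ d + k" by (rule k)
    also have "(k * (n + c) + k) = k * (n + c + 1)" by simp
    also have "k * (k * (n + c + 1)) ^ d + k \<le> k * (k * (n + c + 1)) ^ d + k * (n + c + 1) ^ d"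
      by simp
    also have "\<dots> = (k * k ^ d + k) * (n + c + 1) ^ d"
      by (simp only: power_mult_distrib distrib_right mult.assoc)
    also have "\<dots> \<le> (k * k ^ d + k) * ((c + 1) * (n + 1)) ^ d"
      by (intro mult_left_mono power_mono) (simp_all add: algebra_simps)
    finally show ?thesis by (simp only: power_mult_distrib mult.assoc)
  qed
  then show ?thesis by blast
qed

text \<open>Lengths are passed along a chain of generating sets: from \<open>S\<close> to
  \<open>S1\<close> by comparison in \<open>G\<close>, from \<open>S1\<close> to \<open>T1\<close>
  by the lower estimate of the embedding, from \<open>T1\<close> to \<open>T0\<close> by comparison
  in \<open>C\<close>. Each passage is at most linear, so the growth bound for \<open>T0\<close>
  survives with a new constant.\<close>

lemma subgroup_growth_bound:
  assumes C: "subgroup C G" and growth: "polynomial_growth_of_degree (G\<lparr>carrier := C\<rparr>) d"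
    and qi: "qi_embedded_subgroup G C"
  shows "\<exists>M. \<forall>n. card (C \<inter> ball n) \<le> M * (n + 1) ^ d"
proof -
  let ?H = "G\<lparr>carrier := C\<rparr>"
  have H: "group ?H" by (rule subgroup_imp_group[OF C])
  obtain T0 where T0: "finite_generating_set ?H T0"
    and gr: "Growth (cayley_graph ?H T0) (carrier ?H) = growth_class (\<lambda>n. n ^ d)"
    using growth by (auto simp: polynomial_growth_of_degree_def)
  obtain S1 T1 where S1: "finite_generating_set G S1" and T1: "finite_generating_set ?H T1"
    and "quasi_isometric_embedding C (word_metric ?H T1) (word_metric G S1) (\<lambda>x. x)"
    using qi by (auto simp: qi_embedded_subgroup_def)
  then obtain L c :: real where L: "L \<ge> 1" "c \<ge> 0"
    and emb: "\<And>x y. x \<in> C \<Longrightarrow> y \<in> C \<Longrightarrow> real (word_metric ?H T1 x y) / L - c \<le> real (word_metric G S1 x y)"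
    by (auto simp: quasi_isometric_embedding_def)
  interpret G1: cayley G S1 by unfold_locales (rule S1)
  interpret H0: cayley ?H T0 by (rule cayley.intro[OF H]) (unfold_locales, rule T0)
  interpret H1: cayley ?H T1 by (rule cayley.intro[OF H]) (unfold_locales, rule T1)
  obtain M where M: "\<And>n. card (H0.ball n) \<le> M * (n + 1) ^ d" using H0.polynomial_growth_bound[OF gr] by blast
  obtain k1 where k1: "\<And>n. ball n \<subseteq> G1.ball (k1 * n)"
    using G1.word_ball_comparison[OF finite_S S_carrier] by blast
  obtain k2 where k2: "\<And>n. H1.ball n \<subseteq> H0.ball (k2 * n)"
    using H0.word_ball_comparison[OF H1.finite_S H1.S_carrier] by blast
  \<comment> \<open>Solving \<open>dist / L - c \<le> k1 * n\<close> for the distance gives at most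
    \<open>L * (k1 + c) * (n + 1)\<close>.\<close>
  define N where "N = nat \<lceil>L * (k1 + c)\<rceil>"
  have sub: "C \<inter> ball n \<subseteq> H0.ball (k2 * (N * (n + 1)))" for n
  proof
    fix x assume x: "x \<in> C \<inter> ball n"
    have one: "\<one> \<in> C" by (rule subgroup.one_closed[OF C])
    have xc: "x \<in> carrier G" using x ball_carrier by auto
    have "inv \<one> \<otimes> x \<in> G1.ball (k1 * n)" using k1[of n] x xc by auto
    then have "word_metric G S1 \<one> x \<le> k1 * n" using G1.graph_dist_le_iff[OF one_closed xc] by simp
    then have "real (word_metric G S1 \<one> x) \<le> real (k1 * n)" by (simp only: of_nat_le_iff)
    moreover have "x \<in> C" using x by simp
    ultimately have "real (word_metric ?H T1 \<one> x) / L - c \<le> real (k1 * n)"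
      using emb[OF one, of x] by linarith
    then have "real (word_metric ?H T1 \<one> x) \<le> L * (k1 * n + c)"
      using L by (simp add: field_simps)
    also have "\<dots> \<le> L * ((k1 + c) * real (n + 1))"
      using L by (intro mult_left_mono) (simp_all add: algebra_simps)
    also have "\<dots> = (L * (k1 + c)) * real (n + 1)" by simp
    also have "\<dots> \<le> real N * real (n + 1)"
      unfolding N_def by (intro mult_right_mono) linarith+
    finally have "real (word_metric ?H T1 \<one> x) \<le> real (N * (n + 1))"
      by (simp only: of_nat_mult)
    then have "word_metric ?H T1 \<one> x \<le> N * (n + 1)" by (simp only: of_nat_le_iff)
    then have "inv\<^bsub>?H\<^esub> \<one> \<otimes>\<^bsub>?H\<^esub> x \<in> H1.ball (N * (n + 1))"
      using H1.graph_dist_le_iff[of \<one> x "N * (n + 1)"] one x by simp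
    moreover have "inv\<^bsub>?H\<^esub> \<one> = \<one>" using H0.inv_one by simp
    ultimately show "x \<in> H0.ball (k2 * (N * (n + 1)))" using k2 xc by auto
  qed
  have "card (C \<inter> ball n) \<le> (M * (k2 * N + 1) ^ d) * (n + 1) ^ d" for n
  proof -
    have "card (C \<inter> ball n) \<le> card (H0.ball (k2 * (N * (n + 1))))"
      by (rule card_mono[OF H0.finite_ball sub])
    also have "\<dots> \<le> M * (k2 * (N * (n + 1)) + 1) ^ d" by (rule M)
    also have "\<dots> \<le> M * ((k2 * N + 1) * (n + 1)) ^ d"
      by (intro mult_left_mono power_mono) (simp_all add: algebra_simps)
    finally show ?thesis by (simp only: power_mult_distrib mult.assoc)
  qed
  then show ?thesis by blast
qed

end

section \<open>Containing the fire\<close>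

lemma capacity_enumeration:
  fixes D :: "nat \<Rightarrow> 'b set" and f :: "nat \<Rightarrow> nat"
  assumes mono: "\<And>n. D n \<subseteq> D (Suc n)" and fin: "\<And>n. finite (D n)"
    and card: "\<And>n. card (D n) \<le> (\<Sum>i=1..n. f i)"
  shows "\<exists>W. (\<forall>n. W n \<subseteq> (\<Union>k. D k) \<and> finite (W n) \<and> card (W n) \<le> f n)
    \<and> (\<forall>n. D n \<subseteq> (\<Union>i\<in>{1..n}. W i))"
proof -
  have "\<exists>L. \<forall>n. (set (L n) = D n \<and> distinct (L n)) \<and> take (length (L n)) (L (Suc n)) = L n"
  proof (rule dependent_nat_choice)
    show "\<exists>xs. set xs = D 0 \<and> distinct xs" using finite_distinct_list[OF fin] .
    fix xs n assume xs: "set xs = D n \<and> distinct xs"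
    obtain ys where "set ys = D (Suc n) - D n" "distinct ys"
      using finite_distinct_list[of "D (Suc n) - D n"] fin[of "Suc n"] by auto
    then show "\<exists>ys. (set ys = D (Suc n) \<and> distinct ys) \<and> take (length xs) ys = xs"
      using xs mono[of n] by (intro exI[of _ "xs @ ys"]) auto
  qed
  then obtain L where L: "\<And>n. set (L n) = D n" "\<And>n. distinct (L n)"
    and pre: "\<And>n. take (length (L n)) (L (Suc n)) = L n" by metis
  have len: "length (L n) = card (D n)" for n using L distinct_card by metis
  have ext: "j < length (L (m + k)) \<and> L (m + k) ! j = L m ! j" if "j < length (L m)" for j m k
  proof (induction k)
    case (Suc k)
    have "L (m + k) ! j = L (Suc (m + k)) ! j" using pre[of "m + k"] Suc by (metis nth_take)
    moreover have "length (L (m + k)) \<le> length (L (Suc (m + k)))"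
      unfolding len by (rule card_mono[OF fin mono])
    ultimately show ?case using Suc by simp
  qed (use that in simp)
  \<comment> \<open>By \<open>ext\<close> every list that is long enough has the same entry at
    \<open>j\<close>, so this is the limit of the lists.\<close>
  define enum where "enum j = L (LEAST m. j < length (L m)) ! j" for j
  have enum: "enum j = L n ! j" if j: "j < length (L n)" for j n
  proof -
    define m where "m = (LEAST m. j < length (L m))"
    have "j < length (L m)" "m \<le> n" unfolding m_def using j by (auto intro: LeastI Least_le)
    then show ?thesis using ext[of j m "n - m"] by (simp add: enum_def m_def)
  qed
  define F where "F n = (\<Sum>i=1..n. f i)" for n
  define W where "W i = (if i = 0 then {} else enum ` {j \<in> {F (i - 1)..<F i}. \<exists>m. j < length (L m)})" for i
  have "W n \<subseteq> (\<Union>k. D k)" for n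
  proof
    fix x assume "x \<in> W n"
    then obtain j m where "x = enum j" "j < length (L m)" by (auto simp: W_def split: if_splits)
    then have "x \<in> D m" using enum[of j m] L(1)[of m] nth_mem by metis
    then show "x \<in> (\<Union>k. D k)" by blast
  qed
  moreover have "finite (W n)" for n by (simp add: W_def)
  moreover have "card (W n) \<le> f n" for n
  proof (cases n)
    case (Suc k)
    have "card (W n) \<le> card {j \<in> {F k..<F n}. \<exists>m. j < length (L m)}"
      unfolding W_def using Suc by (simp add: card_image_le)
    also have "\<dots> \<le> card {F k..<F n}" by (intro card_mono) auto
    also have "\<dots> = f n" by (simp add: F_def Suc)
    finally show ?thesis .
  qed (simp add: W_def)
  moreover have "D n \<subseteq> (\<Union>i\<in>{1..n}. W i)" for n
  proof
    fix x assume "x \<in> D n"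
    then obtain j where j: "j < length (L n)" "x = L n ! j" using L(1)[of n] by (metis in_set_conv_nth)
    have "\<exists>i\<in>{1..k}. F (i - 1) \<le> j \<and> j < F i" if "j < F k" for k
      using that
    proof (induction k)
      case (Suc k)
      show ?case
      proof (cases "j < F k")
        case True
        then obtain i where "i \<in> {1..k}" "F (i - 1) \<le> j \<and> j < F i" using Suc.IH by auto
        then show ?thesis by (intro bexI[of _ i]) auto
      next
        case False
        then show ?thesis using Suc.prems by (intro bexI[of _ "Suc k"]) auto
      qed
    qed (simp add: F_def)
    moreover have "j < F n" using j(1) card[of n] by (simp add: len F_def)
    ultimately obtain i where i: "i \<in> {1..n}" "F (i - 1) \<le> j" "j < F i" by blast
    have "x \<in> W i" using i j enum[OF j(1)] by (auto simp: W_def intro!: image_eqI[of _ _ j])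
    then show "x \<in> (\<Union>i\<in>{1..n}. W i)" using i(1) by blast
  qed
  ultimately show ?thesis by blast
qed

text \<open>A discrete mean value estimate for the power \<open>Suc e\<close>.\<close>

lemma power_Suc_le: "Suc n ^ Suc e \<le> n ^ Suc e + Suc e * Suc n ^ e"
proof (induction e)
  case (Suc e)
  have "Suc n ^ Suc (Suc e) \<le> Suc n * (n ^ Suc e + Suc e * Suc n ^ e)"
    using mult_le_mono2[OF Suc, of "Suc n"] by simp
  also have "\<dots> = n ^ Suc (Suc e) + n ^ Suc e + Suc e * Suc n ^ Suc e" by (simp add: algebra_simps)
  also have "n ^ Suc e \<le> Suc n ^ Suc e" by (rule power_mono) simp_all
  finally show ?case by simp
qed simp

text \<open>Discrete integration: a demand of order \<open>n ^ d\<close> by time \<open>n\<close> is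
  met by rounds of order \<open>i ^ (d - 1)\<close>, at the cost of a factor
  \<open>d\<close>.\<close>

lemma power_le_sum_powers:
  assumes "d > 0"
  shows "n ^ d \<le> d * (\<Sum>i=1..n. i ^ (d - 1))"
proof -
  obtain e where d: "d = Suc e" using assms by (cases d) auto
  show ?thesis
  proof (induction n)
    case (Suc n)
    then show ?case using power_Suc_le[of n e] by (simp add: d distrib_left)
  qed (simp add: d)
qed

lemma (in group) coset_boundary_finite:
  assumes bd: "coset_boundary C H" and "finite Y" "Y \<subseteq> carrier G"
  shows "\<exists>F F'. finite F \<and> finite F' \<and> F \<subseteq> carrier G \<and> F' \<subseteq> carrier G
    \<and> (\<forall>s\<in>Y. \<forall>x\<in>H. x \<otimes> s \<notin> H \<longrightarrow> (\<exists>f\<in>F. \<exists>c\<in>C. \<exists>f'\<in>F'. x = f \<otimes> c \<otimes> f'))"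
  using assms(2,3)
proof (induction Y)
  case empty
  show ?case by (rule exI[of _ "{}"], rule exI[of _ "{}"]) simp
next
  case (insert s Y)
  have "s \<in> carrier G" "Y \<subseteq> carrier G" using insert by auto
  obtain F1 F1' where 1: "finite F1" "finite F1'" "F1 \<subseteq> carrier G" "F1' \<subseteq> carrier G"
    "\<forall>s\<in>Y. \<forall>x\<in>H. x \<otimes> s \<notin> H \<longrightarrow> (\<exists>f\<in>F1. \<exists>c\<in>C. \<exists>f'\<in>F1'. x = f \<otimes> c \<otimes> f')"
    using insert.IH[OF \<open>Y \<subseteq> carrier G\<close>] by (elim exE conjE) (rule that)
  obtain F2 F2' where 2: "finite F2" "finite F2'" "F2 \<subseteq> carrier G" "F2' \<subseteq> carrier G"
    "\<forall>x\<in>H. x \<otimes> s \<notin> H \<longrightarrow> (\<exists>f\<in>F2. \<exists>c\<in>C. \<exists>f'\<in>F2'. x = f \<otimes> c \<otimes> f')"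
    using bspec[OF bd[unfolded coset_boundary_def] \<open>s \<in> carrier G\<close>] by (elim exE conjE) (rule that)
  show ?case
  proof (rule exI[of _ "F1 \<union> F2"], rule exI[of _ "F1' \<union> F2'"], intro conjI ballI impI)
    fix s' x assume "s' \<in> insert s Y" "x \<in> H" "x \<otimes> s' \<notin> H"
    then have "(\<exists>f\<in>F1. \<exists>c\<in>C. \<exists>f'\<in>F1'. x = f \<otimes> c \<otimes> f') \<or> (\<exists>f\<in>F2. \<exists>c\<in>C. \<exists>f'\<in>F2'. x = f \<otimes> c \<otimes> f')"
      using 1(5) 2(5) by auto
    then show "\<exists>f\<in>F1 \<union> F2. \<exists>c\<in>C. \<exists>f'\<in>F1' \<union> F2'. x = f \<otimes> c \<otimes> f'" by blast
  qed (use 1 2 in auto)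
qed

section \<open>Counting boundary points and keeping the fire out\<close>

context cayley begin

text \<open>The bound must not involve \<open>q\<close>, which will contain the translation chosen
  after the fire. Comparison with one fixed point \<open>x0 = q c0 f\<close> eliminates it:
  \<open>f (inv x0) x (inv f) = (inv c0) c\<close> lies in \<open>C\<close> and has length at most
  \<open>m + r + r + m\<close>.\<close>

lemma coset_ball_count:
  assumes C: "subgroup C G" and q: "q \<in> carrier G" and f: "f \<in> ball m"
  shows "card {x \<in> ball r. \<exists>c\<in>C. x = q \<otimes> c \<otimes> f} \<le> card (C \<inter> ball (2 * r + 2 * m))"
proof (cases "{x \<in> ball r. \<exists>c\<in>C. x = q \<otimes> c \<otimes> f} = {}")
  case True
  show ?thesis unfolding True by simp
next
  case False
  then obtain x0 c0 where x0: "x0 \<in> ball r" "c0 \<in> C" "x0 = q \<otimes> c0 \<otimes> f" by auto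
  have fc: "f \<in> carrier G" and x0c: "x0 \<in> carrier G" and c0: "c0 \<in> carrier G"
    using f x0 ball_carrier subgroup.mem_carrier[OF C] by auto
  show ?thesis
  proof (rule card_inj_on_le[of "\<lambda>x. f \<otimes> inv x0 \<otimes> (x \<otimes> inv f)"])
    show "inj_on (\<lambda>x. f \<otimes> inv x0 \<otimes> (x \<otimes> inv f)) {x \<in> ball r. \<exists>c\<in>C. x = q \<otimes> c \<otimes> f}"
    proof (rule inj_onI)
      fix x y
      assume "x \<in> {x \<in> ball r. \<exists>c\<in>C. x = q \<otimes> c \<otimes> f}" "y \<in> {x \<in> ball r. \<exists>c\<in>C. x = q \<otimes> c \<otimes> f}"
        and eq: "f \<otimes> inv x0 \<otimes> (x \<otimes> inv f) = f \<otimes> inv x0 \<otimes> (y \<otimes> inv f)"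
      then have "x \<in> carrier G" "y \<in> carrier G" using ball_carrier by auto
      then show "x = y" using eq fc x0c by simp
    qed
    show "(\<lambda>x. f \<otimes> inv x0 \<otimes> (x \<otimes> inv f)) ` {x \<in> ball r. \<exists>c\<in>C. x = q \<otimes> c \<otimes> f} \<subseteq> C \<inter> ball (2 * r + 2 * m)"
    proof (rule image_subsetI)
      fix x assume "x \<in> {x \<in> ball r. \<exists>c\<in>C. x = q \<otimes> c \<otimes> f}"
      then obtain c where x: "x \<in> ball r" "c \<in> C" "x = q \<otimes> c \<otimes> f" by auto
      have c: "c \<in> carrier G" using x subgroup.mem_carrier[OF C] by auto
      have "f \<otimes> inv x0 \<otimes> (x \<otimes> inv f) = inv c0 \<otimes> c"
        unfolding x(3) x0(3) using fc c c0 q by (simp add: m_assoc inv_mult_group)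
      then have "f \<otimes> inv x0 \<otimes> (x \<otimes> inv f) \<in> C"
        using x0 x subgroup.m_closed[OF C] subgroup.m_inv_closed[OF C] by simp
      moreover have "f \<otimes> inv x0 \<otimes> (x \<otimes> inv f) \<in> ball ((m + r) + (r + m))"
        using f x0(1) x(1) by (intro ball_mult ball_inv)
      moreover have "(m + r) + (r + m) = 2 * r + 2 * m" by simp
      ultimately show "f \<otimes> inv x0 \<otimes> (x \<otimes> inv f) \<in> C \<inter> ball (2 * r + 2 * m)" by simp
    qed
    show "finite (C \<inter> ball (2 * r + 2 * m))" using finite_ball by simp
  qed
qed

text \<open>To enter \<open>V\<close> in round \<open>Suc n\<close>, the fire must step from a
  vertex outside \<open>V\<close> to a vertex of \<open>V\<close> within \<open>Suc n\<close> of
  \<open>X0\<close>. That vertex is protected by this round and was not burning before, so the step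
  is blocked. The distance bound is part of the induction because protection is scheduled by
  distance.\<close>

lemma fire_contained:
  assumes X0: "X0 \<subseteq> carrier G" "X0 \<inter> V = {}"
    and W: "\<And>n u v. \<lbrakk>v \<in> V; v \<in> nbhd X0 n; u \<notin> V; (u, v) \<in> arcs_ends \<Gamma>\<rbrakk> \<Longrightarrow> v \<in> (\<Union>i\<in>{1..n}. W i)"
  shows "fire \<Gamma> W X0 n \<subseteq> nbhd X0 n - V"
proof (induction n)
  case 0
  have "x \<in> nbhd X0 0" if "x \<in> X0" for x using that X0 by (auto simp: nbhd_def intro!: bexI[of _ x])
  then show ?case using X0 by auto
next
  case (Suc n)
  show ?case
  proof
    fix v assume "v \<in> fire \<Gamma> W X0 (Suc n)"
    then obtain p where p: "vwalk p \<Gamma>" "hd p \<in> fire \<Gamma> W X0 n" "last p = v" "vwalk_length p \<le> 1"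
      and avoid: "set p \<inter> ((\<Union>i\<in>{1..Suc n}. W i) - fire \<Gamma> W X0 n) = {}"
      by (simp only: fire.simps mem_Collect_eq) (elim exE conjE)
    show "v \<in> nbhd X0 (Suc n) - V"
    proof (cases "v \<in> fire \<Gamma> W X0 n")
      case True
      then show ?thesis using Suc nbhd_mono[of n "Suc n" X0] by auto
    next
      case False
      obtain u q where uq: "p = u # q" using p(1) by (cases p) (auto simp: vwalk_def)
      have "q \<noteq> []" using False p uq by auto
      then have "p = [u, v]" using p uq by (cases q) auto
      then have uv: "(u, v) \<in> arcs_ends \<Gamma>" "u \<in> fire \<Gamma> W X0 n" using p by (auto simp: vwalk_def)
      have "u \<in> nbhd X0 n" "u \<notin> V" using Suc uv by auto
      then obtain a where a: "a \<in> X0" "inv a \<otimes> u \<in> ball n" by (auto simp: nbhd_def)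
      have c: "u \<in> carrier G" "v \<in> carrier G" "a \<in> carrier G"
        using uv(1) a X0 by (auto simp: arcs_ends_cayley)
      have "(inv a \<otimes> u) \<otimes> (inv u \<otimes> v) \<in> ball (n + 1)" by (rule ball_mult[OF a(2) arcs_ends_ball[OF uv(1)]])
      then have "inv a \<otimes> v \<in> ball (Suc n)" using c by (simp add: m_assoc del: word_ball.simps)
      then have v: "v \<in> nbhd X0 (Suc n)" using a(1) c unfolding nbhd_def by blast
      moreover have "v \<notin> V"
      proof
        assume "v \<in> V"
        from W[OF this v \<open>u \<notin> V\<close> uv(1)] show False using avoid False \<open>p = [u, v]\<close> by auto
      qed
      ultimately show ?thesis by simp
    qed
  qed
qed

lemma half_space_retaining:
  assumes C: "subgroup C G" and H: "half_space C H" and d: "d > 0"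
    and M: "\<And>n. card (C \<inter> ball n) \<le> M * (n + 1) ^ d"
  shows "polynomial_retaining_property \<Gamma> (d - 1)"
proof -
  have HG: "H \<subseteq> carrier G" and bd: "coset_boundary C H"
    and "\<exists>F. finite F \<and> F \<subseteq> carrier G \<and> (\<forall>x\<in>carrier G. \<exists>f\<in>F. f \<otimes> x \<in> H \<or> f \<otimes> inv x \<in> H)"
    and far: "\<And>X. finite X \<and> X \<subseteq> carrier G \<Longrightarrow> \<exists>g\<in>carrier G. \<forall>x\<in>X. g \<otimes> x \<notin> H"
    using H unfolding half_space_def by simp_all
  then obtain F where F: "finite F" "F \<subseteq> carrier G"
    and cover: "\<forall>x\<in>carrier G. \<exists>f\<in>F. f \<otimes> x \<in> H \<or> f \<otimes> inv x \<in> H"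
    by (elim exE conjE)
  define Y where "Y = S \<union> (\<lambda>s. inv s) ` S"
  have Y: "finite Y" "Y \<subseteq> carrier G" using finite_S S_carrier by (auto simp: Y_def)
  obtain F1 F2 where F12: "finite F1" "finite F2" "F1 \<subseteq> carrier G" "F2 \<subseteq> carrier G"
    and walls: "\<forall>s\<in>Y. \<forall>x\<in>H. x \<otimes> s \<notin> H \<longrightarrow> (\<exists>f\<in>F1. \<exists>c\<in>C. \<exists>f'\<in>F2. x = f \<otimes> c \<otimes> f')"
    using coset_boundary_finite[OF bd Y] by (elim exE conjE) (rule that)
  obtain m where m: "F2 \<subseteq> ball m" using finite_subset_ball[OF F12(2,4)] by auto
  \<comment> \<open>One factor for each pair of outer factors of the boundary;
    \<open>2 * m + 5\<close> arises since \<open>4 * n + 2 * m + 1\<close> is at most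
    \<open>(2 * m + 5) * n\<close> for positive \<open>n\<close>. The constant is fixed before
    \<open>X0\<close>.\<close>
  define K where "K = card F1 * card F2 * (M * (2 * m + 5) ^ d)"
  \<comment> \<open>The factor \<open>d\<close> pays for the discrete integration, and the added
    \<open>1\<close> makes the rate positive.\<close>
  have "\<exists>W. strategy \<Gamma> (\<lambda>n. (K * d + 1) * n ^ (d - 1)) W \<and> retaining \<Gamma> W X0"
    if X0: "finite X0" "X0 \<subseteq> carrier G" for X0
  proof -
    obtain r where r: "X0 \<subseteq> ball r" using finite_subset_ball[OF X0] by auto
    have "finite (ball (2 * r)) \<and> ball (2 * r) \<subseteq> carrier G" using finite_ball ball_carrier by auto
    then obtain g where g: "g \<in> carrier G" and "\<forall>x\<in>ball (2 * r). g \<otimes> x \<notin> H"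
      using far[of "ball (2 * r)"] by auto
    then have gfar: "g \<otimes> x \<notin> H" if "x \<in> ball (2 * r)" for x using that by simp
    define V where "V = {x \<in> carrier G. g \<otimes> x \<in> H}"
    define B where "B = {x \<in> V. \<exists>s\<in>Y. x \<otimes> s \<notin> V}"
    define D where "D n = B \<inter> nbhd X0 n" for n
    have D_coset: "\<exists>f\<in>F1. \<exists>f'\<in>F2. \<exists>c\<in>C. x = (inv g \<otimes> f) \<otimes> c \<otimes> f'" if x: "x \<in> B" for x
    proof -
      obtain s where s: "s \<in> Y" "x \<otimes> s \<notin> V" and xV: "x \<in> carrier G" "g \<otimes> x \<in> H"
        using x by (auto simp: B_def V_def)
      have "s \<in> carrier G" using s Y by auto
      then have "(g \<otimes> x) \<otimes> s \<notin> H" using s xV g by (simp add: V_def m_assoc)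
      then have "\<exists>f\<in>F1. \<exists>c\<in>C. \<exists>f'\<in>F2. g \<otimes> x = f \<otimes> c \<otimes> f'" using walls s(1) xV(2) by simp
      then obtain f c f' where e: "f \<in> F1" "c \<in> C" "f' \<in> F2" "g \<otimes> x = f \<otimes> c \<otimes> f'" by (elim bexE)
      have "f \<in> carrier G" "c \<in> carrier G" "f' \<in> carrier G"
        using e F12 subgroup.mem_carrier[OF C] by auto
      then have "inv g \<otimes> (g \<otimes> x) = (inv g \<otimes> f) \<otimes> c \<otimes> f'" unfolding e(4) using g by (simp add: m_assoc)
      then have "x = (inv g \<otimes> f) \<otimes> c \<otimes> f'" using g xV by simp
      then show ?thesis using e by blast
    qed
    \<comment> \<open>A boundary point within \<open>n\<close> of the fire has length at most
      \<open>r + n\<close>, while the choice of \<open>g\<close> excludes length at most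
      \<open>2 * r\<close>. Hence \<open>r < n\<close>, and \<open>2 * n\<close> is a bound free of
      \<open>r\<close>.\<close>
    have D_ball: "r < n \<and> x \<in> ball (2 * n)" if x: "x \<in> D n" for x n
    proof -
      obtain a where a: "a \<in> X0" "inv a \<otimes> x \<in> ball n" and xc: "x \<in> carrier G" and xV: "x \<in> V"
        using x by (auto simp: D_def B_def nbhd_def)
      have "a \<in> ball r" using a r by auto
      then have "a \<otimes> (inv a \<otimes> x) \<in> ball (r + n)" using a by (intro ball_mult)
      then have xb: "x \<in> ball (r + n)" using xc a X0 by auto
      have "r < n"
      proof (rule ccontr)
        assume "\<not> r < n"
        then have "x \<in> ball (2 * r)" by (intro ball_mono[OF xb]) simp
        then show False using gfar xV by (auto simp: V_def)
      qed
      moreover from this have "x \<in> ball (2 * n)" by (intro ball_mono[OF xb]) simp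
      ultimately show ?thesis by simp
    qed
    have D_card: "card (D n) \<le> K * n ^ d" for n
    proof (cases "n = 0")
      case True
      then have "D n = {}" using D_ball[of _ n] by auto
      then show ?thesis by simp
    next
      case False
      define Z where "Z f f' = {x \<in> ball (2 * n). \<exists>c\<in>C. x = (inv g \<otimes> f) \<otimes> c \<otimes> f'}" for f f'
      have "D n \<subseteq> (\<Union>(f, f')\<in>F1 \<times> F2. Z f f')"
      proof
        fix x assume x: "x \<in> D n"
        then have "\<exists>f\<in>F1. \<exists>f'\<in>F2. \<exists>c\<in>C. x = (inv g \<otimes> f) \<otimes> c \<otimes> f'"
          by (intro D_coset) (simp add: D_def)
        then obtain f f' where ff: "f \<in> F1" "f' \<in> F2" "\<exists>c\<in>C. x = (inv g \<otimes> f) \<otimes> c \<otimes> f'" by (elim bexE) (rule that, auto)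
        then have "x \<in> Z f f'" using D_ball[OF x] by (simp add: Z_def)
        then show "x \<in> (\<Union>(f, f')\<in>F1 \<times> F2. Z f f')" using ff by auto
      qed
      then have "card (D n) \<le> card (\<Union>(f, f')\<in>F1 \<times> F2. Z f f')"
        using F12 finite_ball by (intro card_mono) (auto simp: Z_def)
      also have "\<dots> \<le> (\<Sum>(f, f')\<in>F1 \<times> F2. card (Z f f'))"
        using card_UN_le[of "F1 \<times> F2" "\<lambda>(f, f'). Z f f'"] F12 by (simp add: case_prod_unfold)
      also have "\<dots> \<le> (\<Sum>(f, f')\<in>F1 \<times> F2. M * (2 * m + 5) ^ d * n ^ d)"
      proof (rule sum_mono, clarify)
        fix f f' assume ff: "f \<in> F1" "f' \<in> F2"
        have "card (Z f f') \<le> card (C \<inter> ball (2 * (2 * n) + 2 * m))"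
          unfolding Z_def using ff F12 m g by (intro coset_ball_count[OF C]) auto
        also have "\<dots> \<le> M * (2 * (2 * n) + 2 * m + 1) ^ d" by (rule M)
        also have "\<dots> \<le> M * ((2 * m + 5) * n) ^ d"
        proof (intro mult_left_mono power_mono)
          have "2 * m * 1 \<le> 2 * m * n" using False by (intro mult_left_mono) simp_all
          then show "2 * (2 * n) + 2 * m + 1 \<le> (2 * m + 5) * n" using False by (simp add: algebra_simps)
        qed simp_all
        finally show "card (Z f f') \<le> M * (2 * m + 5) ^ d * n ^ d"
          by (simp only: power_mult_distrib mult.assoc)
      qed
      also have "\<dots> = K * n ^ d" by (simp add: K_def card_cartesian_product)
      finally show ?thesis .
    qed
    have D_budget: "card (D n) \<le> (\<Sum>i=1..n. (K * d + 1) * i ^ (d - 1))" for n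
    proof -
      have "card (D n) \<le> K * n ^ d" by (rule D_card)
      also have "\<dots> \<le> K * (d * (\<Sum>i=1..n. i ^ (d - 1)))" by (intro mult_left_mono power_le_sum_powers d) simp
      also have "\<dots> \<le> (K * d + 1) * (\<Sum>i=1..n. i ^ (d - 1))" by simp
      finally show ?thesis by (simp only: sum_distrib_left)
    qed
    have "\<exists>W. (\<forall>n. W n \<subseteq> (\<Union>k. D k) \<and> finite (W n) \<and> card (W n) \<le> (K * d + 1) * n ^ (d - 1))
        \<and> (\<forall>n. D n \<subseteq> (\<Union>i\<in>{1..n}. W i))"
    proof (rule capacity_enumeration)
      show "D n \<subseteq> D (Suc n)" for n using nbhd_mono[of n "Suc n" X0] by (auto simp: D_def)
      show "finite (D n)" for n using finite_nbhd[OF X0] by (simp add: D_def)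
    qed (rule D_budget)
    then obtain W where W: "\<forall>n. W n \<subseteq> (\<Union>k. D k) \<and> finite (W n) \<and> card (W n) \<le> (K * d + 1) * n ^ (d - 1)"
      and WD: "\<forall>n. D n \<subseteq> (\<Union>i\<in>{1..n}. W i)"
      by (elim exE conjE)
    have "(\<Union>k. D k) \<subseteq> carrier G" by (auto simp: D_def nbhd_def)
    then have "strategy \<Gamma> (\<lambda>n. (K * d + 1) * n ^ (d - 1)) W"
      using W unfolding strategy_def verts_cayley by (meson subset_trans)
    moreover have "retaining \<Gamma> W X0"
    proof -
      have fire: "fire \<Gamma> W X0 n \<subseteq> nbhd X0 n - V" for n
      proof (rule fire_contained[OF X0(2)])
        show "X0 \<inter> V = {}"
        proof -
          have "x \<notin> V" if "x \<in> X0" for x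
          proof -
            have "x \<in> ball r" using that r by auto
            then have "x \<in> ball (2 * r)" by (rule ball_mono) simp
            then show ?thesis using gfar by (auto simp: V_def)
          qed
          then show ?thesis by auto
        qed
        fix n u v assume v: "v \<in> V" "v \<in> nbhd X0 n" and u: "u \<notin> V" and uv: "(u, v) \<in> arcs_ends \<Gamma>"
        have "(v, u) \<in> arcs_ends \<Gamma>" using uv unfolding arcs_ends_cayley by blast
        then obtain s where s: "s \<in> S" "u = v \<otimes> s \<or> u = v \<otimes> inv s" using arcs_ends_step by blast
        then have "\<exists>s\<in>Y. u = v \<otimes> s" unfolding Y_def by blast
        then have "v \<in> B" using v u by (auto simp: B_def)
        then have "v \<in> D n" using v by (simp add: D_def)
        then show "v \<in> (\<Union>i\<in>{1..n}. W i)" using WD by blast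
      qed
      define U where "U = verts \<Gamma> - (\<Union>n. fire \<Gamma> W X0 n)"
      have VU: "V \<subseteq> U"
      proof
        fix x assume x: "x \<in> V"
        then have "x \<notin> fire \<Gamma> W X0 n" for n using fire[of n] by auto
        then show "x \<in> U" using x by (auto simp: U_def verts_cayley V_def)
      qed
      have UG: "U \<subseteq> carrier G" by (auto simp: U_def verts_cayley)
      \<comment> \<open>This shift depends on \<open>g\<close>, hence on the fire; growth classes
        absorb it, whereas \<open>K\<close> had to be uniform.\<close>
      obtain c where c: "(\<lambda>f. inv g \<otimes> f) ` F \<subseteq> ball c"
        using finite_subset_ball[of "(\<lambda>f. inv g \<otimes> f) ` F"] F g by auto
      have card: "card (ball n) \<le> (2 * card F) * card (U \<inter> ball (n + c))" for n
      proof -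
        \<comment> \<open>Each \<open>x\<close> in the ball is sent into \<open>V\<close> either
          directly or through its inverse, which lies in the same ball; for fixed \<open>f\<close>
          both maps are injective, giving the factor \<open>2 * card F\<close>.\<close>
        define P where "P f = {x \<in> ball n. (inv g \<otimes> f) \<otimes> x \<in> U \<inter> ball (n + c)}" for f
        define P' where "P' f = {x \<in> ball n. (inv g \<otimes> f) \<otimes> inv x \<in> U \<inter> ball (n + c)}" for f
        have "ball n \<subseteq> (\<Union>f\<in>F. P f \<union> P' f)"
        proof
          fix x assume x: "x \<in> ball n"
          then have xc: "x \<in> carrier G" by (rule ball_carrier)
          then obtain f where f: "f \<in> F" "f \<otimes> x \<in> H \<or> f \<otimes> inv x \<in> H" using cover by blast
          have fc: "f \<in> carrier G" using f F by auto
          have in_U: "(inv g \<otimes> f) \<otimes> y \<in> U \<inter> ball (n + c)" if "y \<in> ball n" "f \<otimes> y \<in> H" for y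
          proof -
            have yc: "y \<in> carrier G" using that ball_carrier by simp
            have "g \<otimes> ((inv g \<otimes> f) \<otimes> y) = f \<otimes> y" using g fc yc by (simp add: m_assoc)
            then have "(inv g \<otimes> f) \<otimes> y \<in> V" using that g fc yc by (simp add: V_def)
            moreover have "(inv g \<otimes> f) \<otimes> y \<in> ball (c + n)" using c f that by (intro ball_mult) auto
            ultimately show ?thesis using VU by (auto simp: add.commute)
          qed
          show "x \<in> (\<Union>f\<in>F. P f \<union> P' f)"
            using f(2)
          proof
            assume "f \<otimes> x \<in> H"
            then have "x \<in> P f" using in_U[OF x] x by (simp add: P_def)
            then show ?thesis using f(1) by blast
          next
            assume "f \<otimes> inv x \<in> H"
            then have "x \<in> P' f" using in_U[OF ball_inv[OF x]] x by (simp add: P'_def)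
            then show ?thesis using f(1) by blast
          qed
        qed
        then have "card (ball n) \<le> card (\<Union>f\<in>F. P f \<union> P' f)"
          using F finite_ball by (intro card_mono) (auto simp: P_def P'_def)
        also have "\<dots> \<le> (\<Sum>f\<in>F. card (P f \<union> P' f))" by (rule card_UN_le[OF F(1)])
        also have "\<dots> \<le> (\<Sum>f\<in>F. 2 * card (U \<inter> ball (n + c)))"
        proof (rule sum_mono)
          fix f assume "f \<in> F"
          then have fc: "f \<in> carrier G" using F by auto
          have fin: "finite (U \<inter> ball (n + c))" using finite_ball by simp
          have "card (P f) \<le> card (U \<inter> ball (n + c))"
            using fc g ball_carrier fin
            by (intro card_inj_on_le[of "\<lambda>x. (inv g \<otimes> f) \<otimes> x"] inj_onI) (auto simp: P_def)
          moreover have "card (P' f) \<le> card (U \<inter> ball (n + c))"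
          proof (rule card_inj_on_le[of "\<lambda>x. (inv g \<otimes> f) \<otimes> inv x", OF _ _ fin])
            show "inj_on (\<lambda>x. (inv g \<otimes> f) \<otimes> inv x) (P' f)"
            proof (rule inj_onI)
              fix x y
              assume "x \<in> P' f" "y \<in> P' f" and eq: "(inv g \<otimes> f) \<otimes> inv x = (inv g \<otimes> f) \<otimes> inv y"
              then have "x \<in> carrier G" "y \<in> carrier G" using ball_carrier by (auto simp: P'_def)
              then show "x = y" using eq fc g inj_onD[OF inv_inj, of x y] by simp
            qed
          qed (auto simp: P'_def)
          ultimately show "card (P f \<union> P' f) \<le> 2 * card (U \<inter> ball (n + c))"
            using card_Un_le[of "P f" "P' f"] by linarith
        qed
        finally show ?thesis by simp
      qed
      have "U \<noteq> {}"
      proof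
        assume "U = {}"
        then have "card (ball 0) = 0" using card[of 0] by simp
        then show False by simp
      qed
      from Growth_eqI[OF UG this card] show ?thesis by (simp add: retaining_def U_def)
    qed
    ultimately show ?thesis by blast
  qed
  then show ?thesis
    unfolding polynomial_retaining_property_def verts_cayley by (intro exI[of _ "K * d + 1"]) auto
qed

end

theorem theorem5p4:
  fixes G :: "('a, 'm) monoid_scheme" and C S :: "'a set" and d :: nat
  assumes "group G"
    and "finitely_generated G"
    and "splits_over G C"
    and "finitely_generated (G\<lparr>carrier := C\<rparr>)"
    and "polynomial_growth_of_degree (G\<lparr>carrier := C\<rparr>) d"
    and "d > 0"
    and "qi_embedded_subgroup G C"
    and "finite_generating_set G S"
  shows "polynomial_retaining_property (cayley_graph G S) (d - 1)"
proof -
  interpret cayley G S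
    using assms(1,8) by (simp add: cayley_def cayley_axioms_def)
  have C: "subgroup C G" using assms(3) by (simp add: splits_over_def)
  obtain H where H: "half_space C H" using splits_over_half_space[OF assms(3)] by (elim exE)
  obtain M where "\<And>n. card (C \<inter> ball n) \<le> M * (n + 1) ^ d"
    using subgroup_growth_bound[OF C assms(5,7)] by blast
  then show ?thesis by (rule half_space_retaining[OF C H assms(6)])
qed

end
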